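(* Let $m=m(n)$, $p=p(n)\in(0,1)$ with $\ln^2 n=o(m)$, and let $\varepsilon>0$ be a constant such that for all large $n$ either $m<(1-\varepsilon)\frac{n\ln n}{\ln\ln n}$ or $m>(1+\varepsilon)\frac{n\ln n}{\ln\ln n}$. Define \[ a_n=\begin{cases}1 & \text{if } m<(1-\varepsilon)\frac{n\ln n}{\ln\ln n},\\[2pt] \frac{np\ln n}{e^{np}-1} & \text{if } m>(1+\varepsilon)\frac{n\ln n}{\ln\ln n},\end{cases} \] and suppose \[ p\big(1-(1-p)^{n-1}\big)=\frac{\ln n+\ln a_n+c_n}{m} \] with $c_n=o(\ln n)$. Then \[ \lim_{n\to\infty}\Pr\big(\delta(\mathcal{G}(n,m,p))\ge 2\big)=\begin{cases}0 & \text{if } c_n\to-\infty,\\ e^{-e^{-c}} & \text{if } c_n\to c\in(-\infty,\infty),\\ 1 & \text{if } c_n\to\infty,\end{cases} \] where $\delta(\cdot)$ denotes minimum degree.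
   Context: Random intersection graph $\mathcal{G}(n,m,p)$: there is a vertex set $\mathcal{V}$ with $|\mathcal{V}|=n$ and an auxiliary feature set $\mathcal{W}$ with $|\mathcal{W}|=m$. Independently for every pair $(v,w)\in\mathcal{V}\times\mathcal{W}$, the feature $w$ is put into the random set $\mathcal{W}(v)$ with probability $p$. Two distinct vertices $v,v'$ are joined by an edge iff $\mathcal{W}(v)\cap\mathcal{W}(v')\neq\emptyset$. *)

theory Defs
  imports "HOL-Probability.Probability" "HOL-Library.Landau_Symbols"
begin

text \<open>A finite simple graph is a vertex set together with a set of two-element edges.\<close>

type_synonym graph = "nat set \<times> nat set set"

definition vertex_degree :: "graph \<Rightarrow> nat \<Rightarrow> nat" where
  "vertex_degree G v = card {e \<in> snd G. v \<in> e}"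

text \<open>For an empty vertex set the value is unspecified.\<close>

definition min_degree :: "graph \<Rightarrow> nat" where
  "min_degree G = Min (vertex_degree G ` fst G)"

definition intersection_graph :: "nat set \<Rightarrow> (nat \<Rightarrow> nat set) \<Rightarrow> graph" where
  "intersection_graph V F =
     (V, {{v, v'} | v v'. v \<in> V \<and> v' \<in> V \<and> v \<noteq> v' \<and> F v \<inter> F v' \<noteq> {}})"

text \<open>
  Vertices are \<open>{..<n}\<close> and features are \<open>{..<m}\<close>. The incidences \<open>X (v, w)\<close> are
  independent Bernoulli variables; \<open>False\<close> is merely the value that \<^const>\<open>Pi_pmf\<close> assigns
  outside the index set.
\<close>

definition random_intersection_graph :: "nat \<Rightarrow> nat \<Rightarrow> real \<Rightarrow> graph pmf" where
  "random_intersection_graph n m p =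
     map_pmf (\<lambda>X. intersection_graph {..<n} (\<lambda>v. {w \<in> {..<m}. X (v, w)}))
       (Pi_pmf ({..<n} \<times> {..<m}) False (\<lambda>_. bernoulli_pmf p))"

definition feature_threshold :: "nat \<Rightarrow> real" where
  "feature_threshold n = real n * ln (real n) / ln (ln (real n))"

text \<open>
  The second branch is meant for \<open>m > (1 + \<epsilon>) * feature_threshold n\<close>; values of \<open>m\<close> lying
  between the two ranges have to be excluded wherever this is used.
\<close>

definition degree_correction :: "real \<Rightarrow> nat \<Rightarrow> nat \<Rightarrow> real \<Rightarrow> real" where
  "degree_correction \<epsilon> n m p =
     (if real m < (1 - \<epsilon>) * feature_threshold n then 1
      else real n * p * ln (real n) / (exp (real n * p) - 1))"

end

theory Submission
  imports Defs "HOL-Real_Asymp.Real_Asymp"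
begin

text \<open>
  Write \<open>H w\<close> for the vertex set of the feature \<open>w\<close>; these are independent and identically distributed.
  Put \<open>q = p * (1 - (1 - p) ^ (n - 1))\<close> and \<open>s = p\<^sup>2 * (1 - p) ^ (n - 2)\<close>. A vertex is isolated with
  probability \<open>(1 - q) ^ m\<close>, close to \<open>exp (- m * q)\<close>, and pendant with about \<open>n * m * s\<close> times that
  probability. If \<open>m\<close> is small then \<open>n * m * s\<close> tends to \<open>0\<close> and isolated vertices are the
  obstruction; if \<open>m\<close> is large then \<open>n * m * s\<close> is asymptotic to \<open>a\<^sub>n\<close>, which tends to infinity, and
  pendant vertices are the obstruction. In both cases the hypothesis on \<open>q\<close> says that the expected
  number of obstructing vertices is asymptotic to \<open>exp (- c\<^sub>n)\<close>. Since the features are independent, the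
  probability that a set of \<open>k\<close> vertices consists of obstructions can be computed up to a factor tending
  to \<open>1\<close>; hence the binomial moments are Poisson-like and the Bonferroni inequalities apply.
\<close>

subsection \<open>Counting bad vertices\<close>

text \<open>Put x = n p. As m q is asymptotic to ln n and q is close to p (1 - exp (-x)), the
  quantity n m s is close to x ln n / (exp x - 1); this is the origin of \<open>a\<^sub>n\<close>.
  For large x one has x close to n ln n / m, so m = n ln n / ln ln n corresponds to x = ln ln n,
  where exp x overtakes ln n. The constant \<epsilon> keeps x away from this point by a factor, and
  that beats the remaining factor x.

  The condition ln^2 n = o(m) gives m p^2 -> 0, which turns (1 - k q + O(p^2))^m into exp (-k m q)
  with a small relative error. An absolute error would not do, because the expected number exp (-c)
  may tend to 0 or to infinity; moments are compared after multiplication by exp (k c).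

  The hypothesis constrains q rather than p, and for small n p the value q is about n p^2, far below
  p. Bounds on p must be recovered from q. In the large range \<open>a\<^sub>n\<close> depends on p,
  so even m q ~ ln n needs an argument there.\<close>

lemma alternating_binomial_bounds:
  fixes N K :: nat
  shows "even K \<Longrightarrow> (if N = 0 then 1 else 0) \<le> (\<Sum>j\<le>K. (-1) ^ j * real (N choose j))"
    and "odd K \<Longrightarrow> (\<Sum>j\<le>K. (-1) ^ j * real (N choose j)) \<le> (if N = 0 then 1 else 0)"
proof -
  \<comment> \<open>Pascal's rule telescopes the truncated sum into one term with the sign of the
    last summand. \<open>N = 0\<close> is separate because \<open>N - 1\<close> truncates.\<close>
  have eq: "(\<Sum>j\<le>K. (-1) ^ j * real (N choose j)) =
      (if N = 0 then 1 else (-1) ^ K * real ((N - 1) choose K))"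
  proof (cases "N = 0")
    case True
    have "(\<Sum>j\<le>K. (-1) ^ j * real (0 choose j)) = (\<Sum>j\<in>{0}. (-1) ^ j * real (0 choose j))"
      by (rule sum.mono_neutral_right) (auto simp: binomial_eq_0)
    with True show ?thesis by simp
  next
    case False
    have "(\<Sum>j\<le>K. (real N gchoose j) * (-1) ^ j) = (-1) ^ K * (real N - 1 gchoose K)"
      by (rule gbinomial_sum_lower_neg)
    moreover have "real N - 1 = real (N - 1)" using False by simp
    ultimately have "(\<Sum>j\<le>K. (real N gchoose j) * (-1) ^ j) = (-1) ^ K * real ((N - 1) choose K)"
      by (simp only: binomial_gbinomial)
    then show ?thesis using False by (simp add: binomial_gbinomial mult.commute)
  qed
  show "even K \<Longrightarrow> (if N = 0 then 1 else 0) \<le> (\<Sum>j\<le>K. (-1) ^ j * real (N choose j))"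
    unfolding eq by simp
  show "odd K \<Longrightarrow> (\<Sum>j\<le>K. (-1) ^ j * real (N choose j)) \<le> (if N = 0 then 1 else 0)"
    unfolding eq by simp
qed

text \<open>The \<open>k\<close>-th binomial moment of the number of bad vertices.\<close>

definition joint_sum :: "'a pmf \<Rightarrow> 'v set \<Rightarrow> ('v \<Rightarrow> 'a \<Rightarrow> bool) \<Rightarrow> nat \<Rightarrow> real" where
  "joint_sum M V B k =
     (\<Sum>S | S \<subseteq> V \<and> card S = k. measure_pmf.prob M {x. \<forall>v\<in>S. B v x})"

text \<open>Double counting: the \<open>k\<close>-sets whose members are all bad are the
  \<open>k\<close>-subsets of the random set of bad vertices.\<close>

lemma joint_sum_eq_expectation:
  assumes V: "finite V"
  shows "joint_sum M V B k = measure_pmf.expectation M (\<lambda>x. real (card {v\<in>V. B v x} choose k))"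
proof -
  let ?I = "{S. S \<subseteq> V \<and> card S = k}"
  have fin: "finite ?I" using V by (auto intro: finite_subset[of _ "Pow V"])
  have *: "real (card {v\<in>V. B v x} choose k) = (\<Sum>S\<in>?I. indicator {x. \<forall>v\<in>S. B v x} x)" for x
  proof -
    have "(\<Sum>S\<in>?I. indicator {x. \<forall>v\<in>S. B v x} x :: real) =
        real (card {S\<in>?I. \<forall>v\<in>S. B v x})"
      using fin by (simp add: indicator_def sum.If_cases Int_def)
    also have "{S\<in>?I. \<forall>v\<in>S. B v x} = {S. S \<subseteq> {v\<in>V. B v x} \<and> card S = k}" by auto
    also have "card \<dots> = card {v\<in>V. B v x} choose k"
      using V by (intro n_subsets) auto
    finally show ?thesis by simp
  qed
  show ?thesis unfolding * joint_sum_def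
    by (subst Bochner_Integration.integral_sum)
       (auto intro!: measure_pmf.integrable_const_bound[where B = 1] simp: indicator_def)
qed

lemma integrable_card_choose:
  assumes "finite V"
  shows "integrable (measure_pmf M) (\<lambda>x. real (card {v\<in>V. B v x} choose k))"
proof (rule measure_pmf.integrable_const_bound[where B = "real (2 ^ card V)"])
  have "card {v\<in>V. B v x} choose k \<le> 2 ^ card V" for x
  proof -
    have "card {v\<in>V. B v x} choose k \<le> 2 ^ card {v\<in>V. B v x}"
      by (rule binomial_le_pow2)
    also have "\<dots> \<le> 2 ^ card V"
      using assms by (intro power_increasing card_mono) auto
    finally show ?thesis .
  qed
  then show "AE x in measure_pmf M. norm (real (card {v\<in>V. B v x} choose k)) \<le> real (2 ^ card V)"
    by (auto simp flip: of_nat_power)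
qed auto

lemma prob_none_expectation:
  assumes "finite V"
  shows "measure_pmf.prob M {x. \<forall>v\<in>V. \<not> B v x} =
    measure_pmf.expectation M (\<lambda>x. if card {v\<in>V. B v x} = 0 then 1 else 0)"
proof -
  have "(\<lambda>x. if card {v\<in>V. B v x} = 0 then 1 else 0 :: real) = indicator {x. \<forall>v\<in>V. \<not> B v x}"
    using assms by (auto simp: fun_eq_iff indicator_def)
  then show ?thesis by simp
qed

lemma bonferroni:
  assumes "finite V"
  shows "even K \<Longrightarrow> measure_pmf.prob M {x. \<forall>v\<in>V. \<not> B v x} \<le> (\<Sum>j\<le>K. (-1) ^ j * joint_sum M V B j)"
    and "odd K \<Longrightarrow> (\<Sum>j\<le>K. (-1) ^ j * joint_sum M V B j) \<le> measure_pmf.prob M {x. \<forall>v\<in>V. \<not> B v x}"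
proof -
  note int = integrable_card_choose[OF assms, of M B]
  have eq: "(\<Sum>j\<le>K. (-1) ^ j * joint_sum M V B j) =
     measure_pmf.expectation M (\<lambda>x. \<Sum>j\<le>K. (-1) ^ j * real (card {v\<in>V. B v x} choose j))"
    using int by (simp add: joint_sum_eq_expectation[OF assms] Bochner_Integration.integral_sum)
  have i1: "integrable (measure_pmf M) (\<lambda>x. \<Sum>j\<le>K. (-1) ^ j * real (card {v\<in>V. B v x} choose j))"
    using int by auto
  have i2: "integrable (measure_pmf M) (\<lambda>x. if card {v\<in>V. B v x} = 0 then 1 else 0 :: real)"
    by (rule measure_pmf.integrable_const_bound[where B = 1]) auto
  show "even K \<Longrightarrow> measure_pmf.prob M {x. \<forall>v\<in>V. \<not> B v x} \<le> (\<Sum>j\<le>K. (-1) ^ j * joint_sum M V B j)"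
    unfolding eq prob_none_expectation[OF assms]
    by (intro integral_mono i1 i2 alternating_binomial_bounds)
  show "odd K \<Longrightarrow> (\<Sum>j\<le>K. (-1) ^ j * joint_sum M V B j) \<le> measure_pmf.prob M {x. \<forall>v\<in>V. \<not> B v x}"
    unfolding eq prob_none_expectation[OF assms]
    by (intro integral_mono i1 i2 alternating_binomial_bounds)
qed

text \<open>Chebyshev's inequality, from bounding the indicator of N = 0 by (N - \<mu>)^2 / \<mu>^2
  and from 2 (N choose 2) + N = N^2. The parameter \<mu> is free, so that \<open>exp (- c)\<close>
  can take the place of the mean.\<close>

lemma prob_none_second_moment:
  assumes "finite V" "\<mu> > 0"
  shows "measure_pmf.prob M {x. \<forall>v\<in>V. \<not> B v x} \<le>
    (2 * joint_sum M V B 2 + joint_sum M V B 1 - 2 * \<mu> * joint_sum M V B 1 + \<mu>\<^sup>2) / \<mu>\<^sup>2"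
proof -
  note int = integrable_card_choose[OF assms(1), of M B]
  let ?N = "\<lambda>x. card {v\<in>V. B v x}"
  let ?f = "\<lambda>x. (2 * real (?N x choose 2) + real (?N x choose 1) - 2 * \<mu> * real (?N x choose 1) + \<mu>\<^sup>2) / \<mu>\<^sup>2"
  have eq: "(2 * joint_sum M V B 2 + joint_sum M V B 1 - 2 * \<mu> * joint_sum M V B 1 + \<mu>\<^sup>2) / \<mu>\<^sup>2
     = measure_pmf.expectation M ?f"
    unfolding joint_sum_eq_expectation[OF assms(1)]
    using int[of 1] int[of 2] by (simp del: binomial_1 One_nat_def)
  have i1: "integrable (measure_pmf M) ?f"
    using int[of 1] int[of 2] by (auto simp del: binomial_1 One_nat_def)
  have i2: "integrable (measure_pmf M) (\<lambda>x. if card {v\<in>V. B v x} = 0 then 1 else 0 :: real)"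
    by (rule measure_pmf.integrable_const_bound[where B = 1]) auto
  have "(if N = 0 then 1 else 0) \<le>
     (2 * real (N choose 2) + real (N choose 1) - 2 * \<mu> * real (N choose 1) + \<mu>\<^sup>2) / \<mu>\<^sup>2" for N
  proof -
    have "2 * real (N choose 2) = real N * (real N - 1)"
    proof (cases N)
      case (Suc k)
      have "2 * (N choose 2) = N * (N - 1)"
        unfolding choose_two by (intro dvd_mult_div_cancel) auto
      then have "real (2 * (N choose 2)) = real (N * (N - 1))" by simp
      then show ?thesis using Suc by (simp add: algebra_simps)
    qed simp
    then have "2 * real (N choose 2) + real (N choose 1) - 2 * \<mu> * real (N choose 1) + \<mu>\<^sup>2 = (real N - \<mu>)\<^sup>2"
      by (simp add: power2_eq_square algebra_simps)
    then show ?thesis using assms(2) by simp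
  qed
  then show ?thesis unfolding eq prob_none_expectation[OF assms(1)]
    by (intro integral_mono i1 i2)
qed

lemma prob_exists_le_joint_sum:
  assumes "finite V"
  shows "1 - measure_pmf.prob M {x. \<forall>v\<in>V. \<not> B v x} \<le> joint_sum M V B 1"
proof -
  have "{S. S \<subseteq> V \<and> card S = 0} = {{}}"
    using assms by (auto dest: finite_subset)
  then have "joint_sum M V B 0 = 1" by (simp add: joint_sum_def)
  then show ?thesis using bonferroni(2)[OF assms, of 1 M B] by simp
qed

text \<open>The method of factorial moments for the value 0 of a Poisson limit. The truncation level
  is fixed by the exponential series before the limit along \<open>F\<close> is taken, so termwise
  convergence suffices.\<close>

lemma prob_none_tendsto_exp:
  fixes M :: "'i \<Rightarrow> 'a pmf" and V :: "'i \<Rightarrow> 'v set"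
  assumes fin: "\<And>i. finite (V i)"
    and lim: "\<And>k. ((\<lambda>i. joint_sum (M i) (V i) (B i) k) \<longlongrightarrow> l ^ k / fact k) F"
  shows "((\<lambda>i. measure_pmf.prob (M i) {x. \<forall>v\<in>V i. \<not> B i v x}) \<longlongrightarrow> exp (- l)) F"
proof (rule tendstoI)
  fix e :: real assume e: "e > 0"
  define T where "T K = (\<Sum>j\<le>K. (-1) ^ j * (l ^ j / fact j))" for K :: nat
  have "(\<lambda>j. (- l) ^ j / fact j) sums exp (- l)"
    using exp_converges[of "- l"] by (simp add: divide_inverse mult.commute)
  moreover have "(- l) ^ j / fact j = (-1) ^ j * (l ^ j / fact j)" for j
    by (subst power_minus) simp
  ultimately have "T \<longlonglongrightarrow> exp (- l)"
    unfolding T_def sums_def_le by simp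
  then obtain K0 where K0: "\<And>K. K \<ge> K0 \<Longrightarrow> dist (T K) (exp (- l)) < e / 2"
    using e by (metis half_gt_zero lim_sequentially)
  have T: "((\<lambda>i. \<Sum>j\<le>K. (-1) ^ j * joint_sum (M i) (V i) (B i) j) \<longlongrightarrow> T K) F" for K
    unfolding T_def by (intro tendsto_sum tendsto_mult lim tendsto_const)
  have "\<forall>\<^sub>F i in F. dist (\<Sum>j\<le>2 * K0. (-1) ^ j * joint_sum (M i) (V i) (B i) j) (T (2 * K0)) < e / 2"
    using e by (intro tendstoD[OF T]) auto
  moreover have "\<forall>\<^sub>F i in F. dist (\<Sum>j\<le>2 * K0 + 1. (-1) ^ j * joint_sum (M i) (V i) (B i) j) (T (2 * K0 + 1)) < e / 2"
    using e by (intro tendstoD[OF T]) auto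
  ultimately show "\<forall>\<^sub>F i in F. dist (measure_pmf.prob (M i) {x. \<forall>v\<in>V i. \<not> B i v x}) (exp (- l)) < e"
  proof eventually_elim
    case (elim i)
    \<comment> \<open>Two consecutive truncations, one even and one odd, enclose the
      probability.\<close>
    have "even (2 * K0)" "odd (2 * K0 + 1)" by auto
    have "dist (T (2 * K0)) (exp (- l)) < e / 2" "dist (T (2 * K0 + 1)) (exp (- l)) < e / 2"
      by (intro K0; simp)+
    with elim bonferroni(1)[OF fin \<open>even (2 * K0)\<close>, of "M i" i "B i"]
      bonferroni(2)[OF fin \<open>odd (2 * K0 + 1)\<close>, of "M i" i "B i"]
    show ?case unfolding dist_real_def abs_less_iff by argo
  qed
qed

text \<open>
  \<open>exp (- c)\<close> plays the role of the expected number of bad vertices. The case \<open>c \<longlongrightarrow> -\<infinity>\<close> is the second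
  moment method, the case \<open>c \<longlongrightarrow> \<infinity>\<close> the union bound, and the remaining one the sieve.
\<close>

lemma bad_vertices_limit:
  fixes M :: "'i \<Rightarrow> 'a pmf" and V :: "'i \<Rightarrow> 'v set" and c P R :: "'i \<Rightarrow> real"
  assumes fin: "\<And>i. finite (V i)"
    and lim: "\<And>k. ((\<lambda>i. joint_sum (M i) (V i) (B i) k * exp (real k * c i)) \<longlongrightarrow> 1 / fact k) F"
    and P_nonneg: "\<And>i. 0 \<le> P i"
    and upper: "\<forall>\<^sub>F i in F. P i \<le> measure_pmf.prob (M i) {x. \<forall>v\<in>V i. \<not> B i v x}"
    and lower: "\<forall>\<^sub>F i in F. measure_pmf.prob (M i) {x. \<forall>v\<in>V i. \<not> B i v x} \<le> P i + R i"
    and R_nonneg: "\<forall>\<^sub>F i in F. 0 \<le> R i"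
    and R: "((\<lambda>i. R i * exp (c i)) \<longlongrightarrow> 0) F"
  shows "filterlim c at_bot F \<Longrightarrow> (P \<longlongrightarrow> 0) F"
    and "(c \<longlongrightarrow> c\<^sub>0) F \<Longrightarrow> (P \<longlongrightarrow> exp (- exp (- c\<^sub>0))) F"
    and "filterlim c at_top F \<Longrightarrow> (P \<longlongrightarrow> 1) F"
proof -
  let ?Q = "\<lambda>i. measure_pmf.prob (M i) {x. \<forall>v\<in>V i. \<not> B i v x}"
  let ?S = "\<lambda>i. joint_sum (M i) (V i) (B i)"
  have S: "?S i k = (?S i k * exp (real k * c i)) * exp (- c i) ^ k" for i k
  proof -
    have "exp (real k * c i) * exp (- c i) ^ k = exp (real k * c i) * exp (real k * - c i)"
      by (simp only: exp_of_nat_mult)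
    also have "\<dots> = 1" by (simp add: exp_add[symmetric])
    finally show ?thesis by (metis mult.assoc mult.right_neutral)
  qed
  have P_between: "\<forall>\<^sub>F i in F. ?Q i - R i \<le> P i" using lower by eventually_elim simp
  have R_eq: "R i = (R i * exp (c i)) * exp (- c i)" for i by (simp add: exp_minus)
  show "(P \<longlongrightarrow> 0) F" if c: "filterlim c at_bot F"
  proof -
    have e: "((\<lambda>i. exp (c i)) \<longlongrightarrow> 0) F"
      by (rule filterlim_compose[OF exp_at_bot c])
    have S1: "((\<lambda>i. ?S i 1 * exp (c i)) \<longlongrightarrow> 1) F" using lim[of 1] by simp
    have S2: "((\<lambda>i. ?S i 2 * exp (2 * c i)) \<longlongrightarrow> 1 / 2) F" using lim[of 2] by simp
    \<comment> \<open>This is the second-moment bound at \<mu> = \<open>exp (- c i)\<close>, written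
      in normalised moments. The main terms 1 - 2 + 1 cancel, and the remaining one carries the
      factor \<open>exp (c i)\<close>, which tends to 0.\<close>
    have lim0: "((\<lambda>i. 2 * (?S i 2 * exp (2 * c i)) + (?S i 1 * exp (c i)) * exp (c i)
       - 2 * (?S i 1 * exp (c i)) + 1) \<longlongrightarrow> 2 * (1 / 2) + 1 * 0 - 2 * 1 + 1) F"
      by (intro tendsto_intros S1 S2 e)
    have le: "P i \<le> 2 * (?S i 2 * exp (2 * c i)) + (?S i 1 * exp (c i)) * exp (c i)
       - 2 * (?S i 1 * exp (c i)) + 1" if "P i \<le> ?Q i" for i
    proof -
      have "exp (- c i) > 0" by simp
      from prob_none_second_moment[OF fin this, of "M i" i "B i"] that
      have "P i \<le> (2 * ?S i 2 + ?S i 1 - 2 * exp (- c i) * ?S i 1 + (exp (- c i))\<^sup>2) / (exp (- c i))\<^sup>2"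
        by linarith
      also have "\<dots> = 2 * (?S i 2 * exp (2 * c i)) + (?S i 1 * exp (c i)) * exp (c i)
       - 2 * (?S i 1 * exp (c i)) + 1"
      proof -
        have "exp (2 * c i) = exp (c i) * exp (c i)" by (simp add: exp_add[symmetric])
        then show ?thesis by (simp add: exp_minus power2_eq_square add_divide_distrib diff_divide_distrib divide_inverse algebra_simps)
      qed
      finally show ?thesis .
    qed
    show ?thesis
    proof (rule tendsto_sandwich[OF _ eventually_mono[OF upper le] tendsto_const])
      show "\<forall>\<^sub>F i in F. 0 \<le> P i" by (simp add: P_nonneg)
    qed (use lim0 in simp_all)
  qed
  have sandwich: "(P \<longlongrightarrow> l) F" if "(?Q \<longlongrightarrow> l) F" "(R \<longlongrightarrow> 0) F" for l
  proof (rule tendsto_sandwich[OF P_between upper _ that(1)])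
    show "((\<lambda>i. ?Q i - R i) \<longlongrightarrow> l) F" using tendsto_diff[OF that] by simp
  qed
  show "(P \<longlongrightarrow> exp (- exp (- c\<^sub>0))) F" if c: "(c \<longlongrightarrow> c\<^sub>0) F"
  proof (rule sandwich)
    have e: "((\<lambda>i. exp (- c i)) \<longlongrightarrow> exp (- c\<^sub>0)) F" by (intro tendsto_intros c)
    show "(?Q \<longlongrightarrow> exp (- exp (- c\<^sub>0))) F"
    proof (rule prob_none_tendsto_exp[OF fin])
      fix k
      have "((\<lambda>i. (?S i k * exp (real k * c i)) * exp (- c i) ^ k) \<longlongrightarrow> 1 / fact k * exp (- c\<^sub>0) ^ k) F"
        by (intro tendsto_mult lim tendsto_power e)
      then show "((\<lambda>i. ?S i k) \<longlongrightarrow> exp (- c\<^sub>0) ^ k / fact k) F"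
        unfolding S[symmetric] by simp
    qed
    show "(R \<longlongrightarrow> 0) F" using tendsto_mult[OF R e] unfolding R_eq[symmetric] by simp
  qed
  show "(P \<longlongrightarrow> 1) F" if c: "filterlim c at_top F"
  proof (rule sandwich)
    have e: "((\<lambda>i. exp (- c i)) \<longlongrightarrow> 0) F"
      by (rule filterlim_compose[OF exp_at_bot]) (use c in \<open>simp add: filterlim_uminus_at_bot\<close>)
    show "(R \<longlongrightarrow> 0) F" using tendsto_mult[OF R e] unfolding R_eq[symmetric] by simp
    have "((\<lambda>i. ?S i 1 * exp (c i)) \<longlongrightarrow> 1) F" using lim[of 1] by simp
    from tendsto_diff[OF tendsto_const tendsto_mult[OF this e], of 1]
    have lim1: "((\<lambda>i. 1 - ?S i 1) \<longlongrightarrow> 1) F"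
      by (simp add: exp_minus mult.assoc)
    have "1 - ?S i 1 \<le> ?Q i" for i
      using prob_exists_le_joint_sum[OF fin, of "M i" i "B i"] by linarith
    then show "(?Q \<longlongrightarrow> 1) F"
      by (intro tendsto_sandwich[OF always_eventually always_eventually lim1 tendsto_const]) auto
  qed
qed

subsection \<open>Feature sets and degrees\<close>

text \<open>The incidence matrix is read by features instead of by vertices: events about bad
  vertices become conditions on the vertex sets of single features, so probabilities factor over the
  features.\<close>

definition feature_law :: "nat \<Rightarrow> real \<Rightarrow> nat set pmf" where
  "feature_law n p =
     map_pmf (\<lambda>f. {v\<in>{..<n}. f v}) (Pi_pmf {..<n} False (\<lambda>_. bernoulli_pmf p))"

definition features :: "nat \<Rightarrow> nat \<Rightarrow> real \<Rightarrow> (nat \<Rightarrow> nat set) pmf" where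
  "features n m p = Pi_pmf {..<m} {} (\<lambda>_. feature_law n p)"

lemma pmf_feature_law:
  "pmf (feature_law n p) A = (if A \<subseteq> {..<n} then \<Prod>v<n. pmf (bernoulli_pmf p) (v \<in> A) else 0)"
proof (cases "A \<subseteq> {..<n}")
  case True
  then have "(\<lambda>f. {v\<in>{..<n}. f v}) -` {A} = Pi {..<n} (\<lambda>v. {v \<in> A})"
    by (auto simp: Pi_def)
  with True show ?thesis
    by (simp add: feature_law_def pmf_map measure_Pi_pmf_Pi measure_pmf_single)
next
  case False
  then have "(\<lambda>f. {v\<in>{..<n}. f v}) -` {A} = {}" by auto
  with False show ?thesis by (simp add: feature_law_def pmf_map)
qed

lemma set_feature_law: "A \<in> set_pmf (feature_law n p) \<Longrightarrow> A \<subseteq> {..<n}"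
  by (auto simp: set_pmf_eq pmf_feature_law split: if_splits)

lemma set_features: "H \<in> set_pmf (features n m p) \<Longrightarrow> w < m \<Longrightarrow> H w \<subseteq> {..<n}"
  using set_feature_law unfolding features_def
  by (auto simp: set_Pi_pmf PiE_dflt_def subset_iff)

text \<open>Both laws give a configuration the product of its Bernoulli masses, grouped differently.
  Configurations that leave the index ranges have mass 0 on either side, which accounts for the
  other two cases.\<close>

lemma features_altdef:
  "features n m p = map_pmf (\<lambda>X w. {v\<in>{..<n}. w < m \<and> X (v, w)})
     (Pi_pmf ({..<n} \<times> {..<m}) False (\<lambda>_. bernoulli_pmf p))" (is "_ = map_pmf ?g ?P")
proof (rule pmf_eqI)
  fix H :: "nat \<Rightarrow> nat set"
  consider (ok) "\<forall>w. w \<notin> {..<m} \<longrightarrow> H w = {}" "\<forall>w<m. H w \<subseteq> {..<n}"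
    | (out) "\<not> (\<forall>w. w \<notin> {..<m} \<longrightarrow> H w = {})"
    | (big) w where "w < m" "\<not> H w \<subseteq> {..<n}" "\<forall>w. w \<notin> {..<m} \<longrightarrow> H w = {}" by blast
  then show "pmf (features n m p) H = pmf (map_pmf ?g ?P) H"
  proof cases
    case ok
    have "?g X = H \<longleftrightarrow> X \<in> Pi ({..<n} \<times> {..<m}) (\<lambda>(v, w). {v \<in> H w})" for X
    proof -
      have "?g X = H \<longleftrightarrow> (\<forall>w v. v < n \<and> w < m \<and> X (v, w) \<longleftrightarrow> v \<in> H w)"
        by (simp add: fun_eq_iff set_eq_iff)
      also have "\<dots> \<longleftrightarrow> (\<forall>w v. v < n \<and> w < m \<longrightarrow> X (v, w) = (v \<in> H w))"
        using ok by (metis empty_iff lessThan_iff subsetD)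
      also have "\<dots> \<longleftrightarrow> X \<in> Pi ({..<n} \<times> {..<m}) (\<lambda>(v, w). {v \<in> H w})"
        unfolding Pi_def by simp blast
      finally show ?thesis .
    qed
    then have "?g -` {H} = Pi ({..<n} \<times> {..<m}) (\<lambda>(v, w). {v \<in> H w})" by blast
    then have "pmf (map_pmf ?g ?P) H = (\<Prod>(v, w)\<in>{..<n} \<times> {..<m}. pmf (bernoulli_pmf p) (v \<in> H w))"
      by (simp add: pmf_map measure_Pi_pmf_Pi measure_pmf_single case_prod_unfold)
    also have "\<dots> = (\<Prod>v<n. \<Prod>w<m. pmf (bernoulli_pmf p) (v \<in> H w))"
      by (rule prod.cartesian_product[symmetric])
    also have "\<dots> = (\<Prod>w<m. \<Prod>v<n. pmf (bernoulli_pmf p) (v \<in> H w))"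
      by (rule prod.swap)
    also have "\<dots> = pmf (features n m p) H"
      using ok by (auto simp: features_def pmf_Pi pmf_feature_law intro!: prod.cong)
    finally show ?thesis ..
  next
    case out
    then have "?g -` {H} = {}" by auto
    with out show ?thesis by (auto simp: features_def pmf_Pi pmf_map)
  next
    case big
    then have "?g -` {H} = {}" by auto
    with big show ?thesis
      by (auto simp: features_def pmf_Pi pmf_map pmf_feature_law intro!: bexI[of _ w])
  qed
qed

lemma random_intersection_graph_features:
  "random_intersection_graph n m p =
     map_pmf (\<lambda>H. intersection_graph {..<n} (\<lambda>v. {w\<in>{..<m}. v \<in> H w})) (features n m p)"
proof -
  have "intersection_graph {..<n} (\<lambda>v. {w\<in>{..<m}. v \<in> {v\<in>{..<n}. w < m \<and> X (v, w)}}) =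
        intersection_graph {..<n} (\<lambda>v. {w\<in>{..<m}. X (v, w)})" for X
    unfolding intersection_graph_def by (intro arg_cong2[of _ _ _ _ Pair] refl) auto
  then show ?thesis
    unfolding random_intersection_graph_def features_altdef by (simp add: map_pmf_comp)
qed

lemma prob_features:
  "measure_pmf.prob (features n m p) {H. \<forall>w<m. H w \<in> E w} =
     (\<Prod>w<m. measure_pmf.prob (feature_law n p) (E w))"
proof -
  have "{H. \<forall>w<m. H w \<in> E w} = Pi {..<m} E" by auto
  then show ?thesis by (simp add: features_def measure_Pi_pmf_Pi)
qed

section \<open>The law of a single feature\<close>

lemma pmf_feature_law_card:
  assumes p: "0 \<le> p" "p \<le> 1" and A: "A \<subseteq> {..<n}"
  shows "pmf (feature_law n p) A = p ^ card A * (1 - p) ^ (n - card A)"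
proof -
  have "(\<Prod>v<n. pmf (bernoulli_pmf p) (v \<in> A)) = (\<Prod>v<n. if v \<in> A then p else 1 - p)"
    using p by (intro prod.cong) auto
  also have "\<dots> = p ^ card A * (1 - p) ^ card ({..<n} - A)"
    using A by (subst prod.If_cases) (auto simp: Int_absorb1 Diff_eq)
  also have "card ({..<n} - A) = n - card A"
    using A by (simp add: card_Diff_subset finite_subset)
  finally show ?thesis using A by (simp add: pmf_feature_law)
qed

lemma prob_feature_law_disjoint:
  assumes p: "0 \<le> p" "p \<le> 1" and S: "S \<subseteq> {..<n}"
  shows "measure_pmf.prob (feature_law n p) {A. A \<inter> S = {}} = (1 - p) ^ card S"
proof -
  have eq: "(\<lambda>f. {v\<in>{..<n}. f v}) -` {A. A \<inter> S = {}} =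
      Pi {..<n} (\<lambda>v. if v \<in> S then {False} else UNIV)"
    using S by (auto simp: Pi_def split: if_splits)
  have "measure_pmf.prob (feature_law n p) {A. A \<inter> S = {}} =
     (\<Prod>v<n. measure_pmf.prob (bernoulli_pmf p) (if v \<in> S then {False} else UNIV))"
    unfolding feature_law_def measure_map_pmf eq by (rule measure_Pi_pmf_Pi) simp
  also have "\<dots> = (\<Prod>v<n. if v \<in> S then 1 - p else 1)"
    using p by (intro prod.cong) (auto simp: measure_pmf_single)
  also have "\<dots> = (1 - p) ^ card S"
    using S by (subst prod.If_cases) (auto simp: Int_absorb1)
  finally show ?thesis .
qed

text \<open>The features that do not make any vertex of \<open>S\<close> adjacent to another vertex.\<close>

definition null_set :: "nat set \<Rightarrow> nat set set" where
  "null_set S = {A. \<forall>v\<in>S. v \<in> A \<longrightarrow> A = {v}}"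

text \<open>A feature is harmless to \<open>k\<close> vertices if it avoids all of them or is the
  singleton of one of them. At \<open>k = 1\<close> the value is 1 - q.\<close>

definition null_prob :: "nat \<Rightarrow> real \<Rightarrow> nat \<Rightarrow> real" where
  "null_prob n p k = (1 - p) ^ k + real k * p * (1 - p) ^ (n - 1)"

text \<open>The probability that a feature consists of exactly one prescribed pair; the
  \<open>s\<close> of the overview.\<close>

definition pair_prob :: "nat \<Rightarrow> real \<Rightarrow> real" where
  "pair_prob n p = p\<^sup>2 * (1 - p) ^ (n - 2)"

lemma prob_null_set:
  assumes p: "0 \<le> p" "p \<le> 1" and S: "S \<subseteq> {..<n}"
  shows "measure_pmf.prob (feature_law n p) (null_set S) = null_prob n p (card S)"
proof -
  have fin: "finite S" using S finite_subset by blast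
  have "null_set S = {A. A \<inter> S = {}} \<union> (\<lambda>v. {v}) ` S"
    by (auto simp: null_set_def)
  then have "measure_pmf.prob (feature_law n p) (null_set S) =
     measure_pmf.prob (feature_law n p) {A. A \<inter> S = {}} +
     measure_pmf.prob (feature_law n p) ((\<lambda>v. {v}) ` S)"
    by (simp only:) (rule measure_pmf.finite_measure_Union, auto)
  also have "measure_pmf.prob (feature_law n p) ((\<lambda>v. {v}) ` S) = (\<Sum>v\<in>S. pmf (feature_law n p) {v})"
    using fin by (subst measure_measure_pmf_finite) (auto simp: sum.reindex)
  also have "\<dots> = (\<Sum>v\<in>S. p * (1 - p) ^ (n - 1))"
    using S p by (intro sum.cong) (auto simp: pmf_feature_law_card)
  finally show ?thesis using p S by (simp add: prob_feature_law_disjoint null_prob_def)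
qed

lemma prob_pairs:
  assumes p: "0 \<le> p" "p \<le> 1" and \<A>: "\<And>A. A \<in> \<A> \<Longrightarrow> A \<subseteq> {..<n} \<and> card A = 2"
  shows "measure_pmf.prob (feature_law n p) \<A> = real (card \<A>) * pair_prob n p"
proof -
  have "finite \<A>" using \<A> by (auto intro: finite_subset[of _ "Pow {..<n}"])
  then have "measure_pmf.prob (feature_law n p) \<A> = (\<Sum>A\<in>\<A>. pmf (feature_law n p) A)"
    by (rule measure_measure_pmf_finite)
  also have "\<dots> = (\<Sum>A\<in>\<A>. pair_prob n p)"
    using \<A> p by (intro sum.cong) (auto simp: pmf_feature_law_card pair_prob_def)
  finally show ?thesis by simp
qed

lemma pair_prob_nonneg: "p \<le> 1 \<Longrightarrow> 0 \<le> pair_prob n p"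
  by (simp add: pair_prob_def)

lemma null_prob_nonneg: "0 \<le> p \<Longrightarrow> p \<le> 1 \<Longrightarrow> 0 \<le> null_prob n p k"
  by (simp add: null_prob_def)

section \<open>Vertices of degree at most one, described by features\<close>

definition isolated :: "nat \<Rightarrow> nat \<Rightarrow> (nat \<Rightarrow> nat set) \<Rightarrow> bool" where
  "isolated m v H \<longleftrightarrow> (\<forall>w<m. H w \<in> null_set {v})"

text \<open>
  Stronger than having degree one: the edge must stem from a single feature. This makes the joint
  probabilities product-like, and pendant edges with two or more features are negligible.
\<close>

definition pendant :: "nat \<Rightarrow> nat \<Rightarrow> (nat \<Rightarrow> nat set) \<Rightarrow> bool" where
  "pendant m v H \<longleftrightarrow>
     (\<exists>w<m. card (H w) = 2 \<and> v \<in> H w \<and> (\<forall>w'<m. w' \<noteq> w \<longrightarrow> H w' \<in> null_set {v}))"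

text \<open>Features outside \<open>T\<close> may equal the pair as well, so the edge comes from at
  least \<open>j\<close> features. For each fixed \<open>T\<close> this is a product event, ready
  for a union bound.\<close>

definition edge_by :: "nat \<Rightarrow> nat \<Rightarrow> nat \<Rightarrow> nat \<Rightarrow> (nat \<Rightarrow> nat set) \<Rightarrow> bool" where
  "edge_by j m v u H \<longleftrightarrow>
     (\<exists>T. T \<subseteq> {..<m} \<and> card T = j \<and>
       (\<forall>w<m. H w \<in> (if w \<in> T then {{v, u}} else insert {v, u} (null_set {v}))))"

definition neighbours :: "nat \<Rightarrow> nat \<Rightarrow> (nat \<Rightarrow> nat set) \<Rightarrow> nat \<Rightarrow> nat set" where
  "neighbours n m H v = {u. u < n \<and> u \<noteq> v \<and> (\<exists>w<m. v \<in> H w \<and> u \<in> H w)}"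

lemma vertex_degree_intersection_graph:
  assumes "v < n"
  shows "vertex_degree (intersection_graph {..<n} (\<lambda>v. {w\<in>{..<m}. v \<in> H w})) v
     = card (neighbours n m H v)"
proof -
  let ?G = "intersection_graph {..<n} (\<lambda>v. {w\<in>{..<m}. v \<in> H w})"
  have "{e \<in> snd ?G. v \<in> e} = (\<lambda>u. {v, u}) ` neighbours n m H v" (is "?l = ?r")
  proof
    show "?l \<subseteq> ?r"
    proof
      fix e assume "e \<in> ?l"
      then obtain a b where e: "e = {a, b}" "a < n" "b < n" "a \<noteq> b" "v \<in> {a, b}"
        and "{w\<in>{..<m}. a \<in> H w} \<inter> {w\<in>{..<m}. b \<in> H w} \<noteq> {}"
        by (auto simp: intersection_graph_def)
      then obtain w where w: "w < m" "a \<in> H w" "b \<in> H w" by auto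
      show "e \<in> ?r"
      proof (cases "v = a")
        case True
        with e w have "b \<in> neighbours n m H v" by (auto simp: neighbours_def)
        with e True show ?thesis by auto
      next
        case False
        with e w have "a \<in> neighbours n m H v" by (auto simp: neighbours_def)
        with e False show ?thesis by (auto simp: insert_commute)
      qed
    qed
    show "?r \<subseteq> ?l"
      using assms by (fastforce simp: neighbours_def intersection_graph_def)
  qed
  moreover have "inj_on (\<lambda>u. {v, u}) (neighbours n m H v)"
    by (auto simp: inj_on_def doubleton_eq_iff)
  ultimately show ?thesis by (simp add: vertex_degree_def card_image)
qed

lemma finite_neighbours: "finite (neighbours n m H v)"
  by (auto simp: neighbours_def)

lemma min_degree_ge_2_iff:
  assumes "n > 0"
  shows "min_degree (intersection_graph {..<n} (\<lambda>v. {w\<in>{..<m}. v \<in> H w})) \<ge> 2 \<longleftrightarrow>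
    (\<forall>v<n. 2 \<le> card (neighbours n m H v))"
proof -
  have "min_degree (intersection_graph {..<n} (\<lambda>v. {w\<in>{..<m}. v \<in> H w})) =
     Min (vertex_degree (intersection_graph {..<n} (\<lambda>v. {w\<in>{..<m}. v \<in> H w})) ` {..<n})"
    by (simp add: min_degree_def intersection_graph_def)
  also have "\<dots> = Min ((\<lambda>v. card (neighbours n m H v)) ` {..<n})"
    by (intro arg_cong[where f = Min] image_cong refl) (rule vertex_degree_intersection_graph, simp)
  finally show ?thesis using assms by (auto simp: lessThan_empty_iff)
qed

lemma isolated_imp_no_neighbours:
  "isolated m v H \<Longrightarrow> neighbours n m H v = {}"
  by (auto simp: isolated_def neighbours_def null_set_def)

lemma pendant_imp_degree_le_1:
  assumes "pendant m v H"
  shows "card (neighbours n m H v) \<le> 1"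
proof -
  from assms obtain w where w: "w < m" "card (H w) = 2" "v \<in> H w"
    "\<forall>w'<m. w' \<noteq> w \<longrightarrow> H w' \<in> null_set {v}" by (auto simp: pendant_def)
  have "neighbours n m H v \<subseteq> H w - {v}"
  proof
    fix u assume "u \<in> neighbours n m H v"
    then obtain w' where "u \<noteq> v" "w' < m" "v \<in> H w'" "u \<in> H w'" by (auto simp: neighbours_def)
    then show "u \<in> H w - {v}" using w by (cases "w' = w") (auto simp: null_set_def)
  qed
  then have "card (neighbours n m H v) \<le> card (H w - {v})"
    using w(2) by (intro card_mono) (auto intro: card_ge_0_finite)
  with w show ?thesis by simp
qed

text \<open>If \<open>u\<close> is the neighbour of \<open>v\<close>, a feature that contains
  \<open>v\<close> and something else is the pair of \<open>v\<close> and \<open>u\<close>, as any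
  third member would be a second neighbour.\<close>

lemma low_degree_cases:
  assumes H: "\<And>w. w < m \<Longrightarrow> H w \<subseteq> {..<n}" and v: "v < n"
    and deg: "card (neighbours n m H v) \<le> 1"
  obtains (isolated) "isolated m v H"
    | (edge) u where "u < n" "u \<noteq> v" "\<exists>w<m. H w = {v, u}"
        "\<And>w. w < m \<Longrightarrow> H w \<in> insert {v, u} (null_set {v})"
proof (cases "isolated m v H")
  case True
  then show ?thesis by (rule that(1))
next
  case False
  then obtain w where w: "w < m" "v \<in> H w" "H w \<noteq> {v}"
    by (auto simp: isolated_def null_set_def)
  then obtain u where u: "u \<in> H w" "u \<noteq> v" by blast
  have "u \<in> neighbours n m H v" using w u H[of w] by (auto simp: neighbours_def)
  moreover have "x = y" if "x \<in> neighbours n m H v" "y \<in> neighbours n m H v" for x y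
    using deg finite_neighbours that by (metis card_le_Suc0_iff_eq One_nat_def)
  ultimately have nb: "x = u" if "x \<in> neighbours n m H v" for x using that by blast
  have *: "H w' = {v, u}" if "w' < m" "v \<in> H w'" "H w' \<noteq> {v}" for w'
  proof -
    have "x = u" if "x \<in> H w'" "x \<noteq> v" for x
      using \<open>w' < m\<close> \<open>v \<in> H w'\<close> that H[of w'] by (intro nb) (auto simp: neighbours_def)
    then show ?thesis using that by auto
  qed
  show ?thesis
  proof (rule that(2))
    show "u < n" "u \<noteq> v" using u H[of w] w by auto
    show "\<exists>w<m. H w = {v, u}" using *[of w] w by auto
    show "H w \<in> insert {v, u} (null_set {v})" if "w < m" for w
      using *[of w] that by (auto simp: null_set_def)
  qed
qed

lemma edge_imp_edge_by_1:
  assumes "\<exists>w<m. H w = {v, u}" "\<And>w. w < m \<Longrightarrow> H w \<in> insert {v, u} (null_set {v})"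
  shows "edge_by 1 m v u H"
proof -
  from assms(1) obtain w where "w < m" "H w = {v, u}" by blast
  then show ?thesis using assms(2) unfolding edge_by_def by (intro exI[of _ "{w}"]) auto
qed

text \<open>A second feature equal to the pair is the only way for a vertex of degree one to miss
  being \<open>pendant\<close>.\<close>

lemma edge_imp_pendant_or_edge_by_2:
  assumes "u \<noteq> v" "\<exists>w<m. H w = {v, u}" "\<And>w. w < m \<Longrightarrow> H w \<in> insert {v, u} (null_set {v})"
  shows "pendant m v H \<or> edge_by 2 m v u H"
proof -
  from assms(2) obtain w where w: "w < m" "H w = {v, u}" by blast
  show ?thesis
  proof (cases "\<exists>w'<m. w' \<noteq> w \<and> H w' = {v, u}")
    case True
    then obtain w' where "w' < m" "w' \<noteq> w" "H w' = {v, u}" by blast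
    with w assms(3) have "edge_by 2 m v u H"
      unfolding edge_by_def by (intro exI[of _ "{w, w'}"]) auto
    then show ?thesis ..
  next
    case False
    have "card (H w) = 2" using w assms(1) by simp
    moreover have "H w' \<in> null_set {v}" if "w' < m" "w' \<noteq> w" for w'
      using False assms(3)[OF that(1)] that by auto
    ultimately show ?thesis using w unfolding pendant_def by auto
  qed
qed

section \<open>From the minimum degree to counting bad vertices\<close>

lemma prod_if_subset:
  fixes a b :: real
  assumes "T \<subseteq> {..<m}"
  shows "(\<Prod>w<m. if w \<in> T then a else b) = a ^ card T * b ^ (m - card T)"
proof -
  have "card ({..<m} - T) = m - card T"
    using assms by (simp add: card_Diff_subset finite_subset)
  then show ?thesis using assms by (simp add: prod.If_cases Int_absorb1 Diff_eq[symmetric])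
qed

lemma prob_Un_le:
  "measure_pmf.prob M (A \<union> B) \<le> measure_pmf.prob M A + measure_pmf.prob M B"
  by (rule measure_Un_le) auto

lemma prob_UN_le:
  assumes "finite I" "\<And>i. i \<in> I \<Longrightarrow> measure_pmf.prob M (E i) \<le> b"
  shows "measure_pmf.prob M (\<Union>i\<in>I. E i) \<le> real (card I) * b"
proof -
  have "measure_pmf.prob M (\<Union>i\<in>I. E i) \<le> (\<Sum>i\<in>I. measure_pmf.prob M (E i))"
    using assms by (intro measure_pmf.finite_measure_subadditive_finite) auto
  also have "\<dots> \<le> (\<Sum>i\<in>I. b)" by (intro sum_mono assms)
  finally show ?thesis by simp
qed

lemma card_subsets_le_power: "card {T. T \<subseteq> {..<m::nat} \<and> card T = j} \<le> m ^ j"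
proof -
  have "card {T. T \<subseteq> {..<m} \<and> card T = j} = m choose j"
    by (simp add: n_subsets)
  also have "\<dots> \<le> m ^ j"
  proof (cases "j \<le> m")
    case True then show ?thesis by (rule binomial_le_pow)
  qed (simp add: binomial_eq_0)
  finally show ?thesis .
qed

text \<open>Union bound over ordered pairs and sets \<open>T\<close>. Keeping the power with
  exponent \<open>m - j\<close>, which is close to exp (-m q), makes the result comparable with the
  expected number of bad vertices.\<close>

lemma prob_edge_by_le:
  assumes p: "0 \<le> p" "p \<le> 1"
  shows "measure_pmf.prob (features n m p) {H. \<exists>v<n. \<exists>u<n. u \<noteq> v \<and> edge_by j m v u H} \<le>
    (real n)\<^sup>2 * (real m * pair_prob n p) ^ j * (null_prob n p 1 + pair_prob n p) ^ (m - j)"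
proof -
  define I where "I = {(v, u). v < n \<and> u < n \<and> u \<noteq> v} \<times> {T. T \<subseteq> {..<m} \<and> card T = j}"
  let ?E = "\<lambda>((v, u), T). {H. \<forall>w<m. H w \<in> (if w \<in> T then {{v, u}} else insert {v, u} (null_set {v}))}"
  let ?b = "pair_prob n p ^ j * (null_prob n p 1 + pair_prob n p) ^ (m - j)"
  have sub: "{(v, u). v < n \<and> u < n \<and> u \<noteq> v} \<subseteq> {..<n} \<times> {..<n}" by auto
  have fin: "finite I"
    unfolding I_def using finite_subset[OF sub] by (intro finite_cartesian_product) auto
  have "card {(v, u). v < n \<and> u < n \<and> u \<noteq> v} \<le> n\<^sup>2"
    using card_mono[OF _ sub] by (simp add: power2_eq_square)
  then have "card I \<le> n\<^sup>2 * m ^ j"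
    unfolding I_def card_cartesian_product by (intro mult_mono card_subsets_le_power) auto
  then have card: "real (card I) \<le> (real n)\<^sup>2 * real m ^ j"
    by (simp flip: of_nat_power of_nat_mult)
  have "measure_pmf.prob (features n m p) (?E i) \<le> ?b" if i: "i \<in> I" for i
  proof -
    obtain v u T where i_eq: "i = ((v, u), T)" by (metis surj_pair)
    have vu: "v < n" "u < n" "u \<noteq> v" "T \<subseteq> {..<m}" "card T = j" using i unfolding I_def i_eq by auto
    have single: "measure_pmf.prob (feature_law n p) {{v, u}} = pair_prob n p"
      using vu p by (subst prob_pairs) auto
    have null: "measure_pmf.prob (feature_law n p) (null_set {v}) = null_prob n p 1"
      using vu p by (subst prob_null_set) auto
    have "measure_pmf.prob (feature_law n p) (insert {v, u} (null_set {v})) \<le>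
       null_prob n p 1 + pair_prob n p"
      using prob_Un_le[of "feature_law n p" "{{v, u}}" "null_set {v}"]
      unfolding single null by simp
    then have "(\<Prod>w<m. measure_pmf.prob (feature_law n p) (if w \<in> T then {{v, u}} else insert {v, u} (null_set {v})))
      \<le> (\<Prod>w<m. if w \<in> T then pair_prob n p else null_prob n p 1 + pair_prob n p)"
      by (intro prod_mono) (auto simp: single)
    also have "\<dots> = ?b" using vu by (simp add: prod_if_subset)
    finally show ?thesis unfolding i_eq prod.case prob_features .
  qed
  note bound = prob_UN_le[OF fin this]
  have eq: "{H. \<exists>v<n. \<exists>u<n. u \<noteq> v \<and> edge_by j m v u H} = (\<Union>i\<in>I. ?E i)"
  proof (rule set_eqI)
    fix H
    have "H \<in> (\<Union>i\<in>I. ?E i) \<longleftrightarrow> (\<exists>v u T. ((v, u), T) \<in> I \<and> H \<in> ?E ((v, u), T))"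
      by (metis (no_types, lifting) UN_iff surj_pair)
    then show "H \<in> {H. \<exists>v<n. \<exists>u<n. u \<noteq> v \<and> edge_by j m v u H} \<longleftrightarrow> H \<in> (\<Union>i\<in>I. ?E i)"
      by (simp add: edge_by_def I_def)
  qed
  have "measure_pmf.prob (features n m p) (\<Union>i\<in>I. ?E i) \<le> real (card I) * ?b"
    by (rule bound)
  also have "\<dots> \<le> (real n)\<^sup>2 * real m ^ j * ?b"
    by (intro mult_right_mono card mult_nonneg_nonneg zero_le_power add_nonneg_nonneg
      pair_prob_nonneg null_prob_nonneg p)
  finally show ?thesis unfolding eq by (simp add: power_mult_distrib mult_ac)
qed

text \<open>Joint isolation is a condition on each feature separately, because the sets
  \<open>null_set {v}\<close> with \<open>v\<close> in \<open>S\<close> intersect in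
  \<open>null_set S\<close>. This gives an exact formula, in contrast to pendant vertices.\<close>

lemma prob_isolated:
  assumes p: "0 \<le> p" "p \<le> 1" and S: "S \<subseteq> {..<n}"
  shows "measure_pmf.prob (features n m p) {H. \<forall>v\<in>S. isolated m v H} = null_prob n p (card S) ^ m"
proof -
  have "{H. \<forall>v\<in>S. isolated m v H} = {H. \<forall>w<m. H w \<in> null_set S}"
    by (auto simp: isolated_def null_set_def)
  then show ?thesis by (simp add: prob_features prob_null_set[OF p S])
qed

lemma joint_sum_isolated:
  assumes p: "0 \<le> p" "p \<le> 1"
  shows "joint_sum (features n m p) {..<n} (isolated m) k = real (n choose k) * null_prob n p k ^ m"
  using p by (simp add: joint_sum_def prob_isolated n_subsets)

lemma prob_min_degree_features:
  assumes "n > 0"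
  shows "measure_pmf.prob (random_intersection_graph n m p) {G. min_degree G \<ge> 2} =
    measure_pmf.prob (features n m p) {H. \<forall>v<n. 2 \<le> card (neighbours n m H v)}"
  unfolding random_intersection_graph_features measure_map_pmf vimage_def mem_Collect_eq
    min_degree_ge_2_iff[OF assms] ..

lemma prob_mono_features:
  assumes "\<And>H. (\<And>w. w < m \<Longrightarrow> H w \<subseteq> {..<n}) \<Longrightarrow> H \<in> X \<Longrightarrow> H \<in> Y"
  shows "measure_pmf.prob (features n m p) X \<le> measure_pmf.prob (features n m p) Y"
  using assms set_features
  by (intro measure_pmf.finite_measure_mono_AE) (auto simp: AE_measure_pmf_iff)

lemma prob_min_degree_le_isolated:
  assumes "n > 0"
  shows "measure_pmf.prob (random_intersection_graph n m p) {G. min_degree G \<ge> 2} \<le>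
    measure_pmf.prob (features n m p) {H. \<forall>v\<in>{..<n}. \<not> isolated m v H}"
  unfolding prob_min_degree_features[OF assms]
  by (rule prob_mono_features) (force dest: isolated_imp_no_neighbours[of _ _ _ n])

lemma prob_min_degree_le_pendant:
  assumes "n > 0"
  shows "measure_pmf.prob (random_intersection_graph n m p) {G. min_degree G \<ge> 2} \<le>
    measure_pmf.prob (features n m p) {H. \<forall>v\<in>{..<n}. \<not> pendant m v H}"
  unfolding prob_min_degree_features[OF assms]
  by (rule prob_mono_features) (force dest: pendant_imp_degree_le_1[of _ _ _ n])

text \<open>If no vertex is isolated, a degree below two can only come from a vertex with a single
  edge; the error term bounds the probability that one exists.\<close>

lemma prob_min_degree_ge_isolated:
  assumes "n > 0" and p: "0 \<le> p" "p \<le> 1"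
  shows "measure_pmf.prob (features n m p) {H. \<forall>v\<in>{..<n}. \<not> isolated m v H} \<le>
    measure_pmf.prob (random_intersection_graph n m p) {G. min_degree G \<ge> 2} +
    (real n)\<^sup>2 * (real m * pair_prob n p) * (null_prob n p 1 + pair_prob n p) ^ (m - 1)"
proof -
  let ?X = "{H. \<forall>v<n. 2 \<le> card (neighbours n m H v)}"
  let ?Y = "{H. \<exists>v<n. \<exists>u<n. u \<noteq> v \<and> edge_by 1 m v u H}"
  let ?P = "measure_pmf.prob (features n m p)"
  have "?P {H. \<forall>v\<in>{..<n}. \<not> isolated m v H} \<le> ?P (?X \<union> ?Y)"
  proof (rule prob_mono_features)
    fix H assume H: "\<And>w. w < m \<Longrightarrow> H w \<subseteq> {..<n}" and no: "H \<in> {H. \<forall>v\<in>{..<n}. \<not> isolated m v H}"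
    have "H \<in> ?Y" if "v < n" "\<not> 2 \<le> card (neighbours n m H v)" for v
    proof -
      from that have deg: "card (neighbours n m H v) \<le> 1" by simp
      show ?thesis
      proof (rule low_degree_cases[OF H that(1) deg])
        assume "isolated m v H"
        with no that show ?thesis by auto
      next
        fix u assume u: "u < n" "u \<noteq> v" and edge: "\<exists>w<m. H w = {v, u}"
          "\<And>w. w < m \<Longrightarrow> H w \<in> insert {v, u} (null_set {v})"
        from edge_imp_edge_by_1[OF edge] u that(1) show ?thesis by blast
      qed
    qed
    then show "H \<in> ?X \<union> ?Y" by blast
  qed
  also have "\<dots> \<le> ?P ?X + ?P ?Y" by (rule prob_Un_le)
  finally show ?thesis
    using prob_edge_by_le[OF p, of n m 1] by (simp add: prob_min_degree_features[OF assms(1)])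
qed

text \<open>The exceptions are now isolated vertices, rarer than pendant ones by a factor of about
  \<open>a\<^sub>n\<close>, and single edges carried by two features, which gain a further factor m
  s.\<close>

lemma prob_min_degree_ge_pendant:
  assumes "n > 0" and p: "0 \<le> p" "p \<le> 1"
  shows "measure_pmf.prob (features n m p) {H. \<forall>v\<in>{..<n}. \<not> pendant m v H} \<le>
    measure_pmf.prob (random_intersection_graph n m p) {G. min_degree G \<ge> 2} +
    (real n * null_prob n p 1 ^ m +
     (real n)\<^sup>2 * (real m * pair_prob n p)\<^sup>2 * (null_prob n p 1 + pair_prob n p) ^ (m - 2))"
proof -
  let ?X = "{H. \<forall>v<n. 2 \<le> card (neighbours n m H v)}"
  let ?Y = "{H. \<exists>v<n. \<exists>u<n. u \<noteq> v \<and> edge_by 2 m v u H}"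
  \<comment> \<open>The quantifier over \<open>{v}\<close> brings the event into the form of
    \<open>prob_isolated\<close> at \<open>S = {v}\<close>.\<close>
  let ?Z = "\<Union>v\<in>{..<n}. {H. \<forall>v\<in>{v}. isolated m v H}"
  let ?P = "measure_pmf.prob (features n m p)"
  have "?P {H. \<forall>v\<in>{..<n}. \<not> pendant m v H} \<le> ?P (?X \<union> (?Z \<union> ?Y))"
  proof (rule prob_mono_features)
    fix H assume H: "\<And>w. w < m \<Longrightarrow> H w \<subseteq> {..<n}" and no: "H \<in> {H. \<forall>v\<in>{..<n}. \<not> pendant m v H}"
    have "H \<in> ?Z \<union> ?Y" if "v < n" "\<not> 2 \<le> card (neighbours n m H v)" for v
    proof -
      from that have deg: "card (neighbours n m H v) \<le> 1" by simp
      show ?thesis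
      proof (rule low_degree_cases[OF H that(1) deg])
        assume "isolated m v H"
        with that show ?thesis by auto
      next
        fix u assume u: "u < n" "u \<noteq> v" and edge: "\<exists>w<m. H w = {v, u}"
          "\<And>w. w < m \<Longrightarrow> H w \<in> insert {v, u} (null_set {v})"
        from edge_imp_pendant_or_edge_by_2[OF u(2) edge] no that(1)
        have "edge_by 2 m v u H" by auto
        with u that(1) show ?thesis by blast
      qed
    qed
    then show "H \<in> ?X \<union> (?Z \<union> ?Y)" by blast
  qed
  also have "\<dots> \<le> ?P ?X + (?P ?Z + ?P ?Y)"
    using prob_Un_le[of "features n m p" ?X "?Z \<union> ?Y"] prob_Un_le[of "features n m p" ?Z ?Y]
    by linarith
  also have "?P ?Z \<le> real (card {..<n}) * null_prob n p 1 ^ m"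
  proof (rule prob_UN_le)
    show "?P {H. \<forall>v\<in>{v}. isolated m v H} \<le> null_prob n p 1 ^ m" if "v \<in> {..<n}" for v
      using that prob_isolated[OF p, of "{v}" n m] by simp
  qed simp
  finally show ?thesis
    using prob_edge_by_le[OF p, of n m 2] by (simp add: prob_min_degree_features[OF assms(1)])
qed

subsection \<open>Binomial moments of pendant vertices\<close>

text \<open>A fibre of \<open>h\<close> with two vertices determines the pair, a fibre with one
  leaves the partner free (inside or outside \<open>S\<close>), and a larger fibre makes the set
  empty.\<close>

definition edge_features :: "nat set \<Rightarrow> (nat \<Rightarrow> nat) \<Rightarrow> nat \<Rightarrow> nat set set" where
  "edge_features S h w = {A. card A = 2 \<and> {v\<in>S. h v = w} \<subseteq> A}"

text \<open>
  \<open>h v\<close> is the feature that creates the edge at \<open>v\<close>. It need not be injective, because an isolated edge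
  inside \<open>S\<close> serves both of its ends; the bounds below charge a factor \<open>1 / n\<close> for every such coincidence.
\<close>

lemma pendants_imp_edge_features:
  assumes "\<forall>v\<in>S. pendant m v H"
  obtains h where "h \<in> S \<rightarrow>\<^sub>E {..<m}"
    "\<And>w. w < m \<Longrightarrow> H w \<in> (if w \<in> h ` S then edge_features S h w else null_set S)"
proof -
  from assms obtain h0 where h0: "\<And>v. v \<in> S \<Longrightarrow> h0 v < m \<and> card (H (h0 v)) = 2 \<and> v \<in> H (h0 v) \<and>
      (\<forall>w'<m. w' \<noteq> h0 v \<longrightarrow> H w' \<in> null_set {v})"
    unfolding pendant_def by metis
  show ?thesis
  proof (rule that[of "restrict h0 S"])
    show "restrict h0 S \<in> S \<rightarrow>\<^sub>E {..<m}" using h0 by auto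
    fix w assume w: "w < m"
    show "H w \<in> (if w \<in> restrict h0 S ` S then edge_features S (restrict h0 S) w else null_set S)"
    proof (cases "w \<in> restrict h0 S ` S")
      case True
      then obtain v0 where v0: "v0 \<in> S" "w = h0 v0" by auto
      have "v \<in> H w" if "v \<in> S" "restrict h0 S v = w" for v
        using h0[OF that(1)] that by auto
      then have "H w \<in> edge_features S (restrict h0 S) w"
        using h0[OF v0(1)] v0(2) by (auto simp: edge_features_def)
      with True show ?thesis by simp
    next
      case False
      have "H w \<in> null_set {v}" if "v \<in> S" for v
      proof -
        have "w \<noteq> h0 v" using False that by auto
        with h0[OF that] w show ?thesis by blast
      qed
      then have "H w \<in> null_set S" by (auto simp: null_set_def)
      with False show ?thesis by simp
    qed
  qed
qed

text \<open>Each prescribed vertex costs a factor n; this is the source of the charge for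
  coincidences of \<open>h\<close>. The product form also covers \<open>card J > 2\<close>, where
  \<open>n ^ (2 - card J)\<close> would be wrong in \<open>nat\<close>.\<close>

lemma card_pairs_containing:
  assumes J: "J \<subseteq> {..<n}" "J \<noteq> {}"
  shows "card {A. A \<subseteq> {..<n} \<and> card A = 2 \<and> J \<subseteq> A} * n ^ card J \<le> n\<^sup>2"
proof -
  have fin: "finite J" using J finite_subset by blast
  consider "card J = 1" | "card J = 2" | "card J > 2"
  proof -
    have "card J > 0" using J fin by (simp add: card_gt_0_iff)
    then show ?thesis using that by linarith
  qed
  then show ?thesis
  proof cases
    case 1
    then obtain v where v: "J = {v}" by (auto simp: card_1_singleton_iff)
    have "{A. A \<subseteq> {..<n} \<and> card A = 2 \<and> J \<subseteq> A} \<subseteq> (\<lambda>u. {v, u}) ` {..<n}"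
      unfolding v by (auto simp: card_2_iff insert_commute)
    then have "card {A. A \<subseteq> {..<n} \<and> card A = 2 \<and> J \<subseteq> A} \<le> card ((\<lambda>u. {v, u}) ` {..<n})"
      by (intro card_mono) auto
    also have "\<dots> \<le> n" using card_image_le[of "{..<n}" "\<lambda>u. {v, u}"] by simp
    finally have "card {A. A \<subseteq> {..<n} \<and> card A = 2 \<and> J \<subseteq> A} \<le> n" .
    with 1 show ?thesis by (simp add: power2_eq_square)
  next
    case 2
    have "{A. A \<subseteq> {..<n} \<and> card A = 2 \<and> J \<subseteq> A} \<subseteq> {J}"
    proof
      fix A assume A: "A \<in> {A. A \<subseteq> {..<n} \<and> card A = 2 \<and> J \<subseteq> A}"
      then have "finite A" "J \<subseteq> A" "card J = card A" using 2 by (auto intro: finite_subset)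
      then show "A \<in> {J}" using card_subset_eq by blast
    qed
    then have "card {A. A \<subseteq> {..<n} \<and> card A = 2 \<and> J \<subseteq> A} \<le> 1"
      using card_mono[of "{J}"] by simp
    with 2 show ?thesis by simp
  next
    case 3
    have "{A. A \<subseteq> {..<n} \<and> card A = 2 \<and> J \<subseteq> A} = {}"
    proof -
      have "card J \<le> 2" if "A \<subseteq> {..<n}" "card A = 2" "J \<subseteq> A" for A
        using that card_mono[of A J] by (simp add: finite_subset)
      with 3 show ?thesis by fastforce
    qed
    then show ?thesis by (simp only: card.empty mult_0 le0)
  qed
qed

lemma prob_edge_features_le:
  assumes p: "0 \<le> p" "p \<le> 1" and "n > 0" and S: "S \<subseteq> {..<n}" and w: "w \<in> h ` S"
  shows "measure_pmf.prob (feature_law n p) (edge_features S h w) \<le>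
    (real n)\<^sup>2 * pair_prob n p / real n ^ card {v\<in>S. h v = w}"
proof -
  let ?J = "{v\<in>S. h v = w}" and ?A = "{A. A \<subseteq> {..<n} \<and> card A = 2 \<and> {v\<in>S. h v = w} \<subseteq> A}"
  have "measure_pmf.prob (feature_law n p) (edge_features S h w) \<le> measure_pmf.prob (feature_law n p) ?A"
    using set_feature_law by (intro measure_pmf.finite_measure_mono_AE)
      (auto simp: AE_measure_pmf_iff edge_features_def)
  also have "\<dots> = real (card ?A) * pair_prob n p"
    by (rule prob_pairs[OF p]) auto
  also have "\<dots> \<le> (real n)\<^sup>2 / real n ^ card ?J * pair_prob n p"
  proof (intro mult_right_mono pair_prob_nonneg p)
    have "card ?A * n ^ card ?J \<le> n\<^sup>2"
      using S w by (intro card_pairs_containing) auto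
    then have "real (card ?A * n ^ card ?J) \<le> real (n\<^sup>2)" by (rule of_nat_mono)
    then show "real (card ?A) \<le> (real n)\<^sup>2 / real n ^ card ?J"
      using \<open>n > 0\<close> by (simp add: field_simps)
  qed
  finally show ?thesis by simp
qed

lemma prob_edge_features_all_le:
  assumes p: "0 \<le> p" "p \<le> 1" and n: "n > 0" and S: "S \<subseteq> {..<n}" and h: "h \<in> S \<rightarrow>\<^sub>E {..<m}"
  shows "measure_pmf.prob (features n m p)
     {H. \<forall>w<m. H w \<in> (if w \<in> h ` S then edge_features S h w else null_set S)} \<le>
    ((real n)\<^sup>2 * pair_prob n p) ^ card (h ` S) * null_prob n p (card S) ^ (m - card (h ` S)) / real n ^ card S"
proof -
  let ?b = "null_prob n p (card S)" and ?T = "h ` S" and ?d = "\<lambda>w. card {v\<in>S. h v = w}"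
  have fin: "finite S" using S finite_subset by blast
  have T: "?T \<subseteq> {..<m}" using h by auto
  have deg0: "?d w = 0" if "w \<notin> ?T" for w
    using that fin by auto
  have "measure_pmf.prob (features n m p)
     {H. \<forall>w<m. H w \<in> (if w \<in> ?T then edge_features S h w else null_set S)} =
    (\<Prod>w<m. measure_pmf.prob (feature_law n p) (if w \<in> ?T then edge_features S h w else null_set S))"
    by (rule prob_features)
  \<comment> \<open>Features outside the image have an empty fibre, so dividing by
    \<open>real n ^ 0\<close> changes nothing there, and the exponents can be summed over all
    \<open>w < m\<close>. As the fibres partition \<open>S\<close>, they add up to
    \<open>card S\<close>.\<close>
  also have "\<dots> \<le> (\<Prod>w<m. (if w \<in> ?T then (real n)\<^sup>2 * pair_prob n p else ?b) / real n ^ ?d w)"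
  proof (intro prod_mono conjI)
    fix w assume "w \<in> {..<m}"
    show "measure_pmf.prob (feature_law n p) (if w \<in> ?T then edge_features S h w else null_set S)
      \<le> (if w \<in> ?T then (real n)\<^sup>2 * pair_prob n p else ?b) / real n ^ ?d w"
    proof (cases "w \<in> ?T")
      case True
      then show ?thesis using prob_edge_features_le[OF p n S True] by simp
    next
      case False
      then show ?thesis using deg0[OF False] prob_null_set[OF p S] by simp
    qed
  qed simp
  also have "\<dots> = (\<Prod>w<m. if w \<in> ?T then (real n)\<^sup>2 * pair_prob n p else ?b) / real n ^ (\<Sum>w<m. ?d w)"
    by (simp add: prod_dividef power_sum)
  also have "(\<Sum>w<m. ?d w) = card S"
  proof -
    have "(\<Sum>w<m. ?d w) = card (\<Union>w\<in>{..<m}. {v\<in>S. h v = w})"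
      using fin by (subst card_UN_disjoint) auto
    also have "(\<Union>w\<in>{..<m}. {v\<in>S. h v = w}) = S" using h by auto
    finally show ?thesis .
  qed
  finally show ?thesis by (simp add: prod_if_subset[OF T])
qed

text \<open>For injective functions the constant must be 1, since they produce the limit 1 / k!. The
  others are counted crudely, by choosing the image and then a map into it, because their
  contribution vanishes.\<close>

lemma card_funs_image_size_le:
  assumes fin: "finite S"
  shows "card {h \<in> S \<rightarrow>\<^sub>E {..<m::nat}. card (h ` S) = r} \<le>
    m ^ r * (if r = card S then 1 else card S ^ card S)"
proof (cases "r = card S")
  case True
  have "card {h \<in> S \<rightarrow>\<^sub>E {..<m::nat}. card (h ` S) = r} \<le> card (S \<rightarrow>\<^sub>E {..<m})"
    using fin by (intro card_mono finite_PiE) auto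
  with True fin show ?thesis by (simp add: card_PiE)
next
  case False
  let ?F = "{h \<in> S \<rightarrow>\<^sub>E {..<m::nat}. card (h ` S) = r}" and ?I = "{T. T \<subseteq> {..<m} \<and> card T = r}"
  have finI: "finite ?I" by (rule finite_subset[of _ "Pow {..<m}"]) auto
  show ?thesis
  proof (cases "r \<le> card S")
    case True
    have "?F \<subseteq> (\<Union>T\<in>?I. S \<rightarrow>\<^sub>E T)"
    proof
      fix h assume "h \<in> ?F"
      then have "h ` S \<in> ?I" "h \<in> S \<rightarrow>\<^sub>E h ` S" by auto
      then show "h \<in> (\<Union>T\<in>?I. S \<rightarrow>\<^sub>E T)" by blast
    qed
    moreover have "finite (\<Union>T\<in>?I. S \<rightarrow>\<^sub>E T)"
      using fin finI by (intro finite_UN_I finite_PiE) (auto intro: finite_subset)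
    ultimately have "card ?F \<le> card (\<Union>T\<in>?I. S \<rightarrow>\<^sub>E T)" by (rule card_mono[rotated])
    also have "\<dots> \<le> (\<Sum>T\<in>?I. card (S \<rightarrow>\<^sub>E T))" using finI by (rule card_UN_le)
    also have "\<dots> = (\<Sum>T\<in>?I. r ^ card S)" using fin by (intro sum.cong) (auto simp: card_PiE)
    also have "\<dots> = card ?I * r ^ card S" by simp
    also have "\<dots> \<le> m ^ r * card S ^ card S"
      by (intro mult_mono card_subsets_le_power power_mono True) auto
    finally show ?thesis using False by simp
  next
    case gt: False
    have "card (h ` S) \<noteq> r" for h :: "'a \<Rightarrow> nat" using gt card_image_le[OF fin, of h] by auto
    then have "?F = {}" by blast
    then show ?thesis by (metis card.empty le0)
  qed
qed

text \<open>Union bound over \<open>h\<close>, sorted by the size \<open>r\<close> of its image. The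
  main term is \<open>r = card S\<close>; every feature lost costs a factor of order 1 / (n^2 m s),
  which in the pendant range is about 1 / (n a).\<close>

lemma prob_pendants_le:
  assumes p: "0 \<le> p" "p \<le> 1" and n: "n > 0" and S: "S \<subseteq> {..<n}"
  shows "measure_pmf.prob (features n m p) {H. \<forall>v\<in>S. pendant m v H} \<le>
    (\<Sum>r\<le>card S. (if r = card S then 1 else real (card S ^ card S)) *
       ((real n)\<^sup>2 * real m * pair_prob n p) ^ r * null_prob n p (card S) ^ (m - r)) / real n ^ card S"
proof -
  let ?b = "null_prob n p (card S)" and ?y = "(real n)\<^sup>2 * pair_prob n p"
  let ?E = "\<lambda>h. {H. \<forall>w<m. H w \<in> (if w \<in> h ` S then edge_features S h w else null_set S)}"
  let ?F = "\<lambda>r. {h \<in> S \<rightarrow>\<^sub>E {..<m}. card (h ` S) = r}"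
  let ?P = "measure_pmf.prob (features n m p)"
  have fin: "finite S" using S finite_subset by blast
  have finP: "finite (S \<rightarrow>\<^sub>E {..<m})" using fin by (intro finite_PiE) auto
  have y0: "0 \<le> ?y" and b0: "0 \<le> ?b" using p by (auto simp: pair_prob_nonneg null_prob_nonneg)
  have "{H. \<forall>v\<in>S. pendant m v H} \<subseteq> (\<Union>h\<in>S \<rightarrow>\<^sub>E {..<m}. ?E h)"
  proof
    fix H assume "H \<in> {H. \<forall>v\<in>S. pendant m v H}"
    then have "\<forall>v\<in>S. pendant m v H" by simp
    then obtain h where "h \<in> S \<rightarrow>\<^sub>E {..<m}"
      "\<And>w. w < m \<Longrightarrow> H w \<in> (if w \<in> h ` S then edge_features S h w else null_set S)"
      using pendants_imp_edge_features by blast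
    then show "H \<in> (\<Union>h\<in>S \<rightarrow>\<^sub>E {..<m}. ?E h)" by blast
  qed
  then have "?P {H. \<forall>v\<in>S. pendant m v H} \<le> ?P (\<Union>h\<in>S \<rightarrow>\<^sub>E {..<m}. ?E h)"
    by (intro measure_pmf.finite_measure_mono) auto
  also have "\<dots> \<le> (\<Sum>h\<in>S \<rightarrow>\<^sub>E {..<m}. ?P (?E h))"
    using finP by (intro measure_pmf.finite_measure_subadditive_finite) auto
  also have "\<dots> \<le> (\<Sum>h\<in>S \<rightarrow>\<^sub>E {..<m}. ?y ^ card (h ` S) * ?b ^ (m - card (h ` S)) / real n ^ card S)"
    by (intro sum_mono prob_edge_features_all_le p n S)
  also have "\<dots> = (\<Sum>r\<le>card S. \<Sum>h\<in>?F r. ?y ^ card (h ` S) * ?b ^ (m - card (h ` S)) / real n ^ card S)"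
    using finP fin by (subst sum.group) (auto simp: card_image_le)
  also have "\<dots> = (\<Sum>r\<le>card S. real (card (?F r)) * (?y ^ r * ?b ^ (m - r))) / real n ^ card S"
    unfolding sum_divide_distrib by (intro sum.cong refl) simp
  also have "\<dots> \<le> (\<Sum>r\<le>card S. real (m ^ r * (if r = card S then 1 else card S ^ card S)) *
      (?y ^ r * ?b ^ (m - r))) / real n ^ card S"
    by (intro divide_right_mono sum_mono mult_right_mono of_nat_mono card_funs_image_size_le fin
      mult_nonneg_nonneg zero_le_power y0 b0) auto
  also have "\<dots> = (\<Sum>r\<le>card S. (if r = card S then 1 else real (card S ^ card S)) *
       ((real n)\<^sup>2 * real m * pair_prob n p) ^ r * ?b ^ (m - r)) / real n ^ card S"
    by (intro arg_cong2[where f = "(/)"] sum.cong refl) (simp add: power_mult_distrib mult_ac)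
  finally show ?thesis .
qed

text \<open>With \<open>h\<close> injective and all partners outside \<open>S\<close>, the
  configuration determines \<open>h\<close>. The events for different \<open>h\<close> are then
  disjoint and their probabilities add up.\<close>

lemma prob_pendants_ge:
  assumes p: "0 \<le> p" "p \<le> 1" and S: "S \<subseteq> {..<n}" and k: "card S = k"
  shows "(\<Prod>i<k. real (m - i)) * (real (n - k) * pair_prob n p) ^ k * null_prob n p k ^ (m - k) \<le>
    measure_pmf.prob (features n m p) {H. \<forall>v\<in>S. pendant m v H}"
proof -
  let ?P = "measure_pmf.prob (features n m p)"
  define I where "I = {h \<in> S \<rightarrow>\<^sub>E {..<m}. inj_on h S}"
  define D where "D v = (\<lambda>u. {v, u}) ` ({..<n} - S)" for v
  let ?E = "\<lambda>h. {H. \<forall>w<m. H w \<in> (if w \<in> h ` S then D (inv_into S h w) else null_set S)}"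
  have fin: "finite S" using S finite_subset by blast
  have finI: "finite I" unfolding I_def using fin by (intro finite_subset[OF _ finite_PiE[of S "\<lambda>_. {..<m}"]]) auto
  have D_card: "card (D v) = n - k" for v
  proof -
    have "inj_on (\<lambda>u. {v, u}) ({..<n} - S)" by (auto simp: inj_on_def doubleton_eq_iff)
    then show ?thesis unfolding D_def using fin S k by (simp add: card_image card_Diff_subset)
  qed
  have D_null: "A \<notin> null_set S" if "A \<in> D v" "v \<in> S" for A v
    using that by (auto simp: D_def null_set_def)
  have D_single: "A \<inter> S = {v}" if "A \<in> D v" "v \<in> S" for A v
    using that by (auto simp: D_def)
  have D_pair: "A \<subseteq> {..<n} \<and> card A = 2" if "A \<in> D v" "v \<in> S" for A v
    using that S by (auto simp: D_def card_insert_if)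
  have H_D: "H (h v) \<in> D v" if "H \<in> ?E h" "h \<in> I" "v \<in> S" for H h v
  proof -
    have hv: "h v < m" "inv_into S h (h v) = v" "h v \<in> h ` S" using that(2,3) by (auto simp: I_def)
    from that(1) have "H (h v) \<in> (if h v \<in> h ` S then D (inv_into S h (h v)) else null_set S)"
      using hv(1) by blast
    with hv show ?thesis by simp
  qed
  \<comment> \<open>If \<open>h\<close> and \<open>h'\<close> differ at \<open>v\<close>, the
    feature \<open>h v\<close> meets \<open>S\<close> in \<open>v\<close> alone. Under
    \<open>h'\<close> it would be a null feature or meet \<open>S\<close> in another vertex.\<close>
  have disj: "disjoint_family_on ?E I"
    unfolding disjoint_family_on_def
  proof (intro ballI impI, rule ccontr)
    fix h h' assume h: "h \<in> I" "h' \<in> I" "h \<noteq> h'" and "?E h \<inter> ?E h' \<noteq> {}"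
    then obtain H where H: "H \<in> ?E h" "H \<in> ?E h'" by blast
    from h obtain v where v: "v \<in> S" "h v \<noteq> h' v"
      unfolding I_def by (metis (no_types, lifting) PiE_ext mem_Collect_eq)
    have Dv: "H (h v) \<in> D v" by (rule H_D) (use H h v in auto)
    have "h v < m" using h v by (auto simp: I_def)
    show False
    proof (cases "h v \<in> h' ` S")
      case True
      then obtain v' where v': "v' \<in> S" "h v = h' v'" by auto
      have "H (h' v') \<in> D v'" by (rule H_D) (use H h v' in auto)
      with D_single[OF this v'(1)] D_single[OF Dv v(1)] v v' show False by auto
    next
      case False
      with H(2) \<open>h v < m\<close> have "H (h v) \<in> null_set S" by auto
      with D_null[OF Dv v(1)] show False by blast
    qed
  qed
  have PE: "?P (?E h) = (real (n - k) * pair_prob n p) ^ k * null_prob n p k ^ (m - k)" if h: "h \<in> I" for h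
  proof -
    have T: "h ` S \<subseteq> {..<m}" "card (h ` S) = k" using h k by (auto simp: I_def card_image)
    have "measure_pmf.prob (feature_law n p) (D v) = real (n - k) * pair_prob n p" if "v \<in> S" for v
      using prob_pairs[OF p, of "D v" n] D_pair that by (simp add: D_card)
    then have "(\<Prod>w<m. measure_pmf.prob (feature_law n p) (if w \<in> h ` S then D (inv_into S h w) else null_set S))
      = (\<Prod>w<m. if w \<in> h ` S then real (n - k) * pair_prob n p else null_prob n p k)"
      using k by (intro prod.cong refl) (simp add: prob_null_set[OF p S] inv_into_into)
    then show ?thesis unfolding prob_features prod_if_subset[OF T(1)] T(2) .
  qed
  \<comment> \<open>For \<open>m < k\<close> there is no injection, and truncated subtraction puts a
    factor 0 into the product.\<close>
  have "card I = (\<Prod>i<k. m - i)"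
    using card_inj_on_subset_funcset[of S "{..<m}" S] fin k by (simp add: I_def atLeast0LessThan)
  then have "(\<Prod>i<k. real (m - i)) * (real (n - k) * pair_prob n p) ^ k * null_prob n p k ^ (m - k) =
     (\<Sum>h\<in>I. ?P (?E h))"
    by (simp add: PE mult.assoc)
  also have "\<dots> = ?P (\<Union>h\<in>I. ?E h)"
    using finI disj by (intro measure_pmf.finite_measure_finite_Union[symmetric]) auto
  also have "\<dots> \<le> ?P {H. \<forall>v\<in>S. pendant m v H}"
  proof (intro measure_pmf.finite_measure_mono subsetI)
    fix H assume "H \<in> (\<Union>h\<in>I. ?E h)"
    then obtain h where h: "h \<in> I" and H: "H \<in> ?E h" by blast
    have "pendant m v H" if v: "v \<in> S" for v
      unfolding pendant_def
    proof (intro exI conjI allI impI)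
      have Dv: "H (h v) \<in> D v" using H h v by (rule H_D)
      show "h v < m" using h v by (auto simp: I_def)
      show "card (H (h v)) = 2" using D_pair[OF Dv v] by simp
      show "v \<in> H (h v)" using D_single[OF Dv v] by auto
      fix w assume w: "w < m" "w \<noteq> h v"
      show "H w \<in> null_set {v}"
      proof (cases "w \<in> h ` S")
        case True
        then obtain v' where v': "v' \<in> S" "w = h v'" by auto
        have "H w \<in> D v'" unfolding v' using H h v'(1) by (rule H_D)
        from D_single[OF this v'(1)] v' w v show ?thesis by (auto simp: null_set_def)
      next
        case False
        with H w have "H w \<in> null_set S" by auto
        with v show ?thesis by (auto simp: null_set_def)
      qed
    qed
    then show "H \<in> {H. \<forall>v\<in>S. pendant m v H}" by blast
  qed simp
  finally show ?thesis .
qed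

lemma joint_sum_pendant_le:
  assumes p: "0 \<le> p" "p \<le> 1" and n: "n > 0"
  shows "joint_sum (features n m p) {..<n} (pendant m) k \<le> real (n choose k) *
    ((\<Sum>r\<le>k. (if r = k then 1 else real (k ^ k)) *
       ((real n)\<^sup>2 * real m * pair_prob n p) ^ r * null_prob n p k ^ (m - r)) / real n ^ k)" (is "_ \<le> _ * ?B")
proof -
  have "joint_sum (features n m p) {..<n} (pendant m) k \<le> (\<Sum>S | S \<subseteq> {..<n} \<and> card S = k. ?B)"
    unfolding joint_sum_def
  proof (rule sum_mono)
    fix S assume "S \<in> {S. S \<subseteq> {..<n} \<and> card S = k}"
    then show "measure_pmf.prob (features n m p) {H. \<forall>v\<in>S. pendant m v H} \<le> ?B"
      using prob_pendants_le[OF p n, of S m] by blast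
  qed
  then show ?thesis by (simp add: n_subsets)
qed

lemma joint_sum_pendant_ge:
  assumes p: "0 \<le> p" "p \<le> 1"
  shows "real (n choose k) * ((\<Prod>i<k. real (m - i)) * (real (n - k) * pair_prob n p) ^ k * null_prob n p k ^ (m - k))
    \<le> joint_sum (features n m p) {..<n} (pendant m) k" (is "_ * ?B \<le> _")
proof -
  have "(\<Sum>S | S \<subseteq> {..<n} \<and> card S = k. ?B) \<le> joint_sum (features n m p) {..<n} (pendant m) k"
    unfolding joint_sum_def by (intro sum_mono prob_pendants_ge p) auto
  then show ?thesis by (simp add: n_subsets)
qed

subsection \<open>Asymptotics\<close>

lemma power_one_minus_bounds:
  fixes p :: real
  assumes "0 \<le> p" "p \<le> 1"
  shows "\<bar>(1 - p) ^ k - (1 - real k * p)\<bar> \<le> (real k)\<^sup>2 * p\<^sup>2"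
proof -
  have "1 - real k * p \<le> (1 - p) ^ k"
    using Bernoulli_inequality[of "- p" k] assms by simp
  moreover have "(1 - p) ^ k \<le> 1 - real k * p + (real k)\<^sup>2 * p\<^sup>2"
  proof (induction k)
    case (Suc k)
    have "(1 - p) ^ Suc k \<le> (1 - p) * (1 - real k * p + (real k)\<^sup>2 * p\<^sup>2)"
      using Suc assms by (simp add: mult_left_mono)
    also have "\<dots> = 1 - real (Suc k) * p + (real k + (real k)\<^sup>2) * p\<^sup>2 - (real k)\<^sup>2 * p ^ 3"
      by (simp add: algebra_simps power2_eq_square power3_eq_cube)
    also have "\<dots> \<le> 1 - real (Suc k) * p + (real (Suc k))\<^sup>2 * p\<^sup>2"
    proof -
      have "(real k + (real k)\<^sup>2) * p\<^sup>2 \<le> (real (Suc k))\<^sup>2 * p\<^sup>2"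
        by (intro mult_right_mono) (auto simp: power2_eq_square algebra_simps)
      moreover have "0 \<le> (real k)\<^sup>2 * p ^ 3" using assms by simp
      ultimately show ?thesis by linarith
    qed
    finally show ?case .
  qed simp
  ultimately show ?thesis by simp
qed

text \<open>The probability that a feature contains a given vertex and at least one other; the
  \<open>q\<close> of the overview.\<close>

definition useful_prob :: "nat \<Rightarrow> real \<Rightarrow> real" where
  "useful_prob n p = p * (1 - (1 - p) ^ (n - 1))"

lemma useful_prob_bounds:
  assumes "0 \<le> p" "p \<le> 1"
  shows "0 \<le> useful_prob n p" "useful_prob n p \<le> p"
  using assms by (auto simp: useful_prob_def mult_left_le power_le_one)

text \<open>The singleton term is exactly the difference between k p and k q, so the whole error is
  that of expanding (1 - p)^k.\<close>

lemma null_prob_approx: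
  assumes "0 \<le> p" "p \<le> 1"
  shows "\<bar>null_prob n p k - (1 - real k * useful_prob n p)\<bar> \<le> (real k)\<^sup>2 * p\<^sup>2"
proof -
  have "null_prob n p k - (1 - real k * useful_prob n p) = (1 - p) ^ k - (1 - real k * p)"
    by (simp add: null_prob_def useful_prob_def algebra_simps)
  then show ?thesis using power_one_minus_bounds[OF assms, of k] by presburger
qed

lemma pair_prob_le:
  assumes "0 \<le> p" "p \<le> 1"
  shows "pair_prob n p \<le> p\<^sup>2"
  using assms by (simp add: pair_prob_def mult_left_le power_le_one)

lemma power_one_minus_le_exp:
  fixes p :: real
  assumes "p \<le> 1"
  shows "(1 - p) ^ k \<le> exp (- (p * real k))"
proof -
  have "(1 - p) ^ k \<le> exp (- p) ^ k"
    using assms exp_ge_add_one_self[of "- p"] by (intro power_mono) auto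
  then show ?thesis by (simp add: exp_of_nat_mult[symmetric] mult.commute)
qed

text \<open>The deficit is n p (1 - p)^(n-1) with n p = t + p. The part with t is at most t exp (-t)
  <= 1, and the part with p is at most 1.\<close>

lemma p_le_useful_prob:
  assumes p: "0 \<le> p" "p \<le> 1" and n: "n \<ge> 1"
  shows "real n * p \<le> real n * useful_prob n p + 2"
proof -
  define t where "t = p * real (n - 1)"
  have t: "0 \<le> t" using p by (simp add: t_def)
  have "t * (1 - p) ^ (n - 1) \<le> t * exp (- t)"
    unfolding t_def using p by (intro mult_left_mono power_one_minus_le_exp) auto
  also have "\<dots> \<le> 1"
  proof -
    have "t \<le> exp t" using exp_ge_add_one_self[of t] by linarith
    then show ?thesis by (simp add: exp_minus field_simps)
  qed
  finally have "t * (1 - p) ^ (n - 1) \<le> 1" .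
  moreover have "p * (1 - p) ^ (n - 1) \<le> 1" using p by (simp add: mult_le_one power_le_one)
  moreover have "real n * p = t + p" using n by (simp add: t_def algebra_simps of_nat_diff)
  moreover have "real n * useful_prob n p = real n * p - real n * p * (1 - p) ^ (n - 1)"
    by (simp add: useful_prob_def algebra_simps)
  ultimately show ?thesis by (simp add: algebra_simps)
qed

text \<open>Useful when n p is small, where q is much smaller than p. It rests on 1 - exp (-t) >= t
  / (1 + t) with t = (n - 1) p, and on p^2 = p t / (n - 1).\<close>

lemma p_squared_le:
  assumes p: "0 \<le> p" "p \<le> 1" and n: "n \<ge> 2"
  shows "p\<^sup>2 \<le> useful_prob n p * (p + 1 / real (n - 1))"
proof -
  define N where "N = real (n - 1)"
  define t where "t = p * N"
  have N: "N > 0" using n by (simp add: N_def)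
  have t: "0 \<le> t" using p N by (simp add: t_def)
  have "t / (1 + t) \<le> 1 - exp (- t)"
  proof -
    have "exp (- t) \<le> 1 / (1 + t)"
      using exp_ge_add_one_self[of t] t by (simp add: exp_minus field_simps)
    also have "1 / (1 + t) = 1 - t / (1 + t)" using t by (simp add: field_simps)
    finally show ?thesis by simp
  qed
  also have "\<dots> \<le> 1 - (1 - p) ^ (n - 1)"
    using power_one_minus_le_exp[OF p(2), of "n - 1"] by (simp add: t_def N_def)
  finally have "p * (t / (1 + t)) \<le> useful_prob n p"
    unfolding useful_prob_def using p by (intro mult_left_mono) auto
  then have "p * (t / (1 + t)) * ((1 + t) / N) \<le> useful_prob n p * ((1 + t) / N)"
    using t N by (intro mult_right_mono) auto
  moreover have "p * (t / (1 + t)) * ((1 + t) / N) = p * t / N"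
    using t by simp
  moreover have "p * t / N = p\<^sup>2"
    using N by (simp add: t_def power2_eq_square)
  moreover have "(1 + t) / N = p + 1 / N"
    using N by (simp add: t_def field_simps)
  ultimately have "p\<^sup>2 \<le> useful_prob n p * (p + 1 / N)" by metis
  then show ?thesis by (simp only: N_def)
qed

lemma falling_factorial_ratio_tendsto:
  fixes N :: "'i \<Rightarrow> nat"
  assumes "filterlim N at_top F"
  shows "((\<lambda>i. (\<Prod>j<k. real (N i - j)) / real (N i) ^ k) \<longlongrightarrow> 1) F"
proof -
  have "((\<lambda>i. \<Prod>j<k. real (N i - j) / real (N i)) \<longlongrightarrow> (\<Prod>j<k. 1)) F"
  proof (rule tendsto_prod)
    fix j
    have "((\<lambda>i. real (N i - j) / real (N i)) \<longlongrightarrow> 1) F"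
    proof (rule filterlim_compose[OF _ assms])
      show "((\<lambda>n. real (n - j) / real n) \<longlongrightarrow> 1) sequentially" by real_asymp
    qed
    then show "((\<lambda>i. real (N i - j) / real (N i)) \<longlongrightarrow> 1) F" .
  qed
  then show ?thesis by (simp add: prod_dividef)
qed

lemma binomial_ratio_tendsto:
  fixes N :: "'i \<Rightarrow> nat"
  assumes "filterlim N at_top F"
  shows "((\<lambda>i. real (N i choose k) / real (N i) ^ k) \<longlongrightarrow> 1 / fact k) F"
proof -
  have "real (n choose k) = (\<Prod>j<k. real (n - j)) / fact k" for n
  proof (cases "k \<le> n")
    case True
    have "real (n choose k) = (\<Prod>j<k. real n - real j) / fact k"
      by (simp add: binomial_gbinomial gbinomial_prod_rev atLeast0LessThan)
    also have "(\<Prod>j<k. real n - real j) = (\<Prod>j<k. real (n - j))"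
      using True by (intro prod.cong) (auto simp: of_nat_diff)
    finally show ?thesis .
  next
    case False
    then have "(\<Prod>j<k. real (n - j)) = 0" by (intro prod_zero) (auto intro: bexI[of _ n])
    with False show ?thesis by (simp add: binomial_eq_0)
  qed
  moreover have "((\<lambda>i. (\<Prod>j<k. real (N i - j)) / real (N i) ^ k / fact k) \<longlongrightarrow> 1 / fact k) F"
    by (intro tendsto_divide falling_factorial_ratio_tendsto assms tendsto_const) simp
  ultimately show ?thesis by (simp add: mult.commute)
qed

text \<open>The error is kept multiplicative because the power itself may be tiny. The quadratic
  term stems from the logarithm, the linear one from the \<open>j\<close> missing factors.\<close>

lemma power_one_minus_exp_form:
  fixes x :: real
  assumes x: "0 \<le> x" "x \<le> 1 / 2" and j: "j \<le> n"
  shows "\<exists>t. (1 - x) ^ (n - j) * exp (real n * x) = exp t \<and> \<bar>t\<bar> \<le> 2 * real n * x\<^sup>2 + real j * x"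
proof (intro exI conjI)
  let ?t = "real (n - j) * ln (1 - x) + real n * x"
  have "(1 - x) ^ (n - j) = exp (real (n - j) * ln (1 - x))"
    using x by (simp add: exp_of_nat_mult)
  then show "(1 - x) ^ (n - j) * exp (real n * x) = exp ?t" by (simp add: exp_add)
  have "\<bar>ln (1 + - x) - - x\<bar> \<le> 2 * (- x)\<^sup>2"
    using x by (intro abs_ln_one_plus_x_minus_x_bound) auto
  then have ln: "\<bar>ln (1 - x) + x\<bar> \<le> 2 * x\<^sup>2" by simp
  have "\<bar>real (n - j) * (ln (1 - x) + x)\<bar> \<le> real n * (2 * x\<^sup>2)"
    unfolding abs_mult using ln by (intro mult_mono) auto
  moreover have "?t = real (n - j) * (ln (1 - x) + x) + real j * x"
    using j by (simp add: of_nat_diff algebra_simps)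
  moreover have "0 \<le> real j * x" using x by simp
  ultimately show "\<bar>?t\<bar> \<le> 2 * real n * x\<^sup>2 + real j * x"
    unfolding abs_le_iff by linarith
qed

lemma abs_exp_minus_1_le:
  fixes t :: real
  assumes "\<bar>t\<bar> \<le> 1 / 2"
  shows "\<bar>exp t - 1\<bar> \<le> 2 * \<bar>t\<bar>"
proof -
  have "exp t \<le> 1 + 2 * \<bar>t\<bar>" using exp_bound_lemma[of t] assms by simp
  moreover have "1 + t \<le> exp t" by (rule exp_ge_add_one_self)
  ultimately show ?thesis by linarith
qed

text \<open>Everything follows from exp y >= 1 + y at y = x or y = -x. The first two bounds enclose
  \<open>a\<^sub>n\<close> / ln n; the third controls a relative error when n p is small.\<close>

lemma x_over_exp_minus_1_bounds:
  fixes x :: real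
  assumes "x > 0"
  shows "x / (exp x - 1) \<le> 1" "exp (- x) \<le> x / (exp x - 1)" "exp (- x) / (1 - exp (- x)) \<le> 1 / x"
proof -
  have pos: "exp x - 1 > 0" using assms by simp
  have ge: "x \<le> exp x - 1" using exp_ge_add_one_self[of x] by linarith
  with pos show "x / (exp x - 1) \<le> 1" by simp
  have "exp (- x) * (exp x - 1) = 1 - exp (- x)" by (simp add: algebra_simps exp_minus)
  also have "\<dots> \<le> x" using exp_ge_add_one_self[of "- x"] by linarith
  finally show "exp (- x) \<le> x / (exp x - 1)" using pos by (simp add: field_simps)
  have "exp (- x) / (1 - exp (- x)) = 1 / (exp x - 1)"
    using assms by (simp add: exp_minus field_simps)
  also have "\<dots> \<le> 1 / x" using ge assms by (intro divide_left_mono) auto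
  finally show "exp (- x) / (1 - exp (- x)) \<le> 1 / x" .
qed

lemma ln_ln_ge_1: "\<forall>\<^sub>F n in sequentially. ln (ln (real n)) \<ge> 1"
  by real_asymp

text \<open>
  The filter \<open>F\<close> restricts \<open>n\<close> to one of the two ranges of \<open>m\<close>, between which a sequence may alternate.
\<close>

locale regime =
  fixes F :: "nat filter" and m :: "nat \<Rightarrow> nat" and p a c :: "nat \<Rightarrow> real"
  assumes F: "F \<le> sequentially"
    and p: "0 < p n" "p n < 1"
    and m: "(\<lambda>n. (ln (real n))\<^sup>2) \<in> o[F](\<lambda>n. real (m n))"
    and eq: "\<forall>\<^sub>F n in F. real (m n) * useful_prob n (p n) = ln (real n) + ln (a n) + c n"
    and a_pos: "\<forall>\<^sub>F n in F. a n > 0"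
    and ln_a: "((\<lambda>n. ln (a n) / ln (real n)) \<longlongrightarrow> 0) F"
    and c: "((\<lambda>n. c n / ln (real n)) \<longlongrightarrow> 0) F"
begin

abbreviation "q n \<equiv> useful_prob n (p n)"

lemma p': "0 \<le> p n" "p n \<le> 1" using p[of n] by auto

lemma ev_seq: "eventually P sequentially \<Longrightarrow> eventually P F"
  using F by (rule filter_leD)

lemma lim_seq: "(f \<longlongrightarrow> l) sequentially \<Longrightarrow> (f \<longlongrightarrow> l) F"
  using F by (rule tendsto_mono)

lemma n_at_top: "filterlim (\<lambda>n. n) at_top F"
  using F by (simp add: filterlim_def)

lemma ln_pos: "\<forall>\<^sub>F n in F. ln (real n) > 0"
  by (rule ev_seq) real_asymp

lemma m_ge: "\<forall>\<^sub>F n in F. (ln (real n))\<^sup>2 \<le> real (m n)"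
  using landau_o.smallD[OF m, of 1] by simp

lemma m_pos: "\<forall>\<^sub>F n in F. 0 < real (m n)"
  using m_ge ln_pos by eventually_elim (smt (verit) zero_less_power)

lemma m_at_top: "filterlim m at_top F"
proof -
  have "filterlim (\<lambda>n. (ln (real n))\<^sup>2) at_top sequentially" by real_asymp
  then have "filterlim (\<lambda>n. (ln (real n))\<^sup>2) at_top F" using F by (rule filterlim_mono[OF _ order_refl])
  then have "filterlim (\<lambda>n. real (m n)) at_top F" by (rule filterlim_at_top_mono[OF _ m_ge])
  then show ?thesis by (simp only: filterlim_sequentially_iff_filterlim_real)
qed

lemma ln2_m: "((\<lambda>n. (ln (real n))\<^sup>2 / real (m n)) \<longlongrightarrow> 0) F"
  using m by (rule smalloD_tendsto)

lemma mq: "((\<lambda>n. real (m n) * q n / ln (real n)) \<longlongrightarrow> 1) F"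
proof -
  have "((\<lambda>n. 1 + ln (a n) / ln (real n) + c n / ln (real n)) \<longlongrightarrow> 1 + 0 + 0) F"
    by (intro tendsto_add tendsto_const ln_a c)
  moreover have "\<forall>\<^sub>F n in F. 1 + ln (a n) / ln (real n) + c n / ln (real n) = real (m n) * q n / ln (real n)"
    using eq ln_pos by eventually_elim (simp add: field_simps)
  ultimately have "((\<lambda>n. real (m n) * q n / ln (real n)) \<longlongrightarrow> 1 + 0 + 0) F"
    by (rule Lim_transform_eventually)
  then show ?thesis by simp
qed

text \<open>The hypothesis on q, exponentiated: multiplying by \<open>exp (c n)\<close> amounts to
  dividing by n a exp (-m q), the approximate expected number of bad vertices.\<close>

lemma exp_c: "\<forall>\<^sub>F n in F. exp (c n) = exp (real (m n) * q n) / (real n * a n)"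
  using eq a_pos ln_pos
proof eventually_elim
  case (elim n)
  then have "n > 0" by (intro Nat.gr0I) simp
  have "exp (real (m n) * q n) = real n * a n * exp (c n)"
    unfolding elim(1) exp_add using \<open>n > 0\<close> elim(2) by simp
  then show ?case using \<open>n > 0\<close> elim(2) by simp
qed

lemma q_tendsto: "(q \<longlongrightarrow> 0) F"
proof -
  have "((\<lambda>n. (real (m n) * q n / ln (real n)) * ((ln (real n))\<^sup>2 / real (m n)) * (1 / ln (real n))) \<longlongrightarrow> 1 * 0 * 0) F"
    by (intro tendsto_mult mq ln2_m lim_seq) real_asymp
  moreover have "\<forall>\<^sub>F n in F. (real (m n) * q n / ln (real n)) * ((ln (real n))\<^sup>2 / real (m n)) * (1 / ln (real n)) = q n"
    using ln_pos m_pos by eventually_elim (simp add: field_simps power2_eq_square)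
  ultimately have "(q \<longlongrightarrow> 1 * 0 * 0) F"
    by (rule Lim_transform_eventually)
  then show ?thesis by simp
qed

lemma p_tendsto: "(p \<longlongrightarrow> 0) F"
proof (rule tendsto_sandwich[OF _ _ tendsto_const])
  show "\<forall>\<^sub>F n in F. 0 \<le> p n" using p' by simp
  have "((\<lambda>n. q n + 2 / real n) \<longlongrightarrow> 0 + 0) F"
    by (intro tendsto_add q_tendsto lim_seq) real_asymp
  then show "((\<lambda>n. q n + 2 / real n) \<longlongrightarrow> 0) F" by simp
  show "\<forall>\<^sub>F n in F. p n \<le> q n + 2 / real n"
    using ev_seq[OF eventually_ge_at_top[of 1]]
  proof eventually_elim
    case (elim n)
    then have "real n > 0" by simp
    with p_le_useful_prob[OF p' elim, of n] show ?case by (simp add: field_simps)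
  qed
qed

text \<open>The bound is (m q)^2 / m + 4 m q / n, of order ln^2 n / m + ln n / n. The first summand
  is the reason for requiring ln^2 n = o(m).\<close>

lemma mp2_tendsto: "((\<lambda>n. real (m n) * (p n)\<^sup>2) \<longlongrightarrow> 0) F"
proof (rule tendsto_sandwich[OF _ _ tendsto_const])
  let ?u = "\<lambda>n. (real (m n) * q n / ln (real n))\<^sup>2 * ((ln (real n))\<^sup>2 / real (m n)) +
     (real (m n) * q n / ln (real n)) * (4 * ln (real n) / real n)"
  show "\<forall>\<^sub>F n in F. 0 \<le> real (m n) * (p n)\<^sup>2" by simp
  have "(?u \<longlongrightarrow> 1\<^sup>2 * 0 + 1 * 0) F"
    by (intro tendsto_add tendsto_mult tendsto_power mq ln2_m lim_seq) real_asymp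
  then show "(?u \<longlongrightarrow> 0) F" by simp
  show "\<forall>\<^sub>F n in F. real (m n) * (p n)\<^sup>2 \<le> ?u n"
    using ev_seq[OF eventually_ge_at_top[of 2]] ln_pos m_pos
  proof eventually_elim
    case (elim n)
    have n: "real n > 0" using elim by simp
    have q0: "0 \<le> q n" by (rule useful_prob_bounds[OF p'])
    \<comment> \<open>The constant 4 is 2 from here plus 2 from the comparison of n p with n
      q.\<close>
    have "1 / real (n - 1) \<le> 2 / real n" using elim by (simp add: field_simps of_nat_diff)
    moreover have "p n \<le> q n + 2 / real n"
      using p_le_useful_prob[OF p', of n n] n elim by (simp add: field_simps)
    ultimately have "p n + 1 / real (n - 1) \<le> q n + 4 / real n" by simp
    then have "q n * (p n + 1 / real (n - 1)) \<le> q n * (q n + 4 / real n)"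
      using q0 by (rule mult_left_mono)
    with p_squared_le[OF p' elim(1), of n] have "(p n)\<^sup>2 \<le> q n * (q n + 4 / real n)" by linarith
    then have "real (m n) * (p n)\<^sup>2 \<le> real (m n) * (q n * (q n + 4 / real n))"
      by (rule mult_left_mono) simp
    also have "\<dots> = ?u n" using elim(2,3) n by (simp add: field_simps power2_eq_square)
    finally show ?case .
  qed
qed

text \<open>Taking logarithms gives m ln \<beta> = -k m q + O(m p^2), and a fixed number
  \<open>r\<close> of missing factors does not matter since \<beta> tends to 1.\<close>

lemma power_tendsto:
  fixes \<beta> :: "nat \<Rightarrow> real"
  assumes \<beta>: "\<And>n. \<bar>\<beta> n - (1 - real k * q n)\<bar> \<le> C * (p n)\<^sup>2"
  shows "((\<lambda>n. \<beta> n ^ (m n - r) * exp (real k * (real (m n) * q n))) \<longlongrightarrow> 1) F"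
proof -
  \<comment> \<open>The sign of \<open>C\<close> is forced by the assumption at a single index,
    because \<open>p 0\<close> is positive.\<close>
  have C: "0 \<le> C"
  proof (rule ccontr)
    assume "\<not> 0 \<le> C"
    then have "C * (p 0)\<^sup>2 < 0" using p[of 0] by (simp add: mult_less_0_iff)
    with \<beta>[of 0] show False by linarith
  qed
  have z: "\<bar>\<beta> n - 1\<bar> \<le> (real k + C) * p n" for n
  proof -
    have "(p n)\<^sup>2 \<le> p n" using p'[of n] by (simp add: power2_eq_square mult_left_le)
    then have "C * (p n)\<^sup>2 \<le> C * p n" using C by (rule mult_left_mono)
    moreover have "0 \<le> real k * q n" "real k * q n \<le> real k * p n"
      using useful_prob_bounds[OF p', of n n] by (auto intro: mult_left_mono)
    ultimately show ?thesis using \<beta>[of n] by (simp add: algebra_simps)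
  qed
  have "((\<lambda>n. (real k + C) * p n) \<longlongrightarrow> (real k + C) * 0) F"
    by (intro tendsto_mult tendsto_const p_tendsto)
  then have lim_z: "((\<lambda>n. (real k + C) * p n) \<longlongrightarrow> 0) F" by simp
  have z_half: "\<forall>\<^sub>F n in F. (real k + C) * p n < 1 / 2"
    using order_tendstoD(2)[OF lim_z, of "1 / 2"] by simp
  have "((\<lambda>n. \<beta> n - 1) \<longlongrightarrow> 0) F"
    by (rule Lim_null_comparison[OF _ lim_z]) (use z in auto)
  then have \<beta>_lim: "(\<beta> \<longlongrightarrow> 1) F" using LIM_zero_iff by blast
  have "((\<lambda>n. real (m n) * ln (\<beta> n) + real k * (real (m n) * q n)) \<longlongrightarrow> 0) F"
  proof (rule Lim_null_comparison)
    \<comment> \<open>The square comes from the second-order term of the logarithm, the summand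
      \<open>C\<close> from the error in \<beta> itself.\<close>
    let ?D = "2 * (real k + C)\<^sup>2 + C"
    show "((\<lambda>n. ?D * (real (m n) * (p n)\<^sup>2)) \<longlongrightarrow> 0) F"
      using tendsto_mult[OF tendsto_const mp2_tendsto, of ?D] by simp
    show "\<forall>\<^sub>F n in F. norm (real (m n) * ln (\<beta> n) + real k * (real (m n) * q n)) \<le> ?D * (real (m n) * (p n)\<^sup>2)"
      using z_half
    proof eventually_elim
      case (elim n)
      have "\<bar>ln (1 + (\<beta> n - 1)) - (\<beta> n - 1)\<bar> \<le> 2 * (\<beta> n - 1)\<^sup>2"
        using z[of n] elim by (intro abs_ln_one_plus_x_minus_x_bound) linarith
      also have "\<dots> \<le> 2 * ((real k + C) * p n)\<^sup>2"
        using z[of n] by (simp add: abs_le_square_iff[symmetric])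
      finally have "\<bar>ln (\<beta> n) - (\<beta> n - 1)\<bar> \<le> 2 * (real k + C)\<^sup>2 * (p n)\<^sup>2"
        by (simp add: power_mult_distrib)
      with \<beta>[of n] have "\<bar>ln (\<beta> n) + real k * q n\<bar> \<le> ?D * (p n)\<^sup>2"
        by (simp add: algebra_simps)
      then have "real (m n) * \<bar>ln (\<beta> n) + real k * q n\<bar> \<le> real (m n) * (?D * (p n)\<^sup>2)"
        by (rule mult_left_mono) simp
      moreover have "real (m n) * ln (\<beta> n) + real k * (real (m n) * q n) = real (m n) * (ln (\<beta> n) + real k * q n)"
        by (simp add: algebra_simps)
      ultimately show ?case by (simp add: abs_mult mult_ac)
    qed
  qed
  from tendsto_exp[OF this]
  have "((\<lambda>n. exp (real (m n) * ln (\<beta> n) + real k * (real (m n) * q n)) / \<beta> n ^ r) \<longlongrightarrow> exp 0 / 1 ^ r) F"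
    by (intro tendsto_divide tendsto_power \<beta>_lim) auto
  moreover have "\<forall>\<^sub>F n in F. exp (real (m n) * ln (\<beta> n) + real k * (real (m n) * q n)) / \<beta> n ^ r =
      \<beta> n ^ (m n - r) * exp (real k * (real (m n) * q n))"
    using order_tendstoD(1)[OF \<beta>_lim, of 0, simplified]
      filterlim_at_top[THEN iffD1, OF m_at_top, rule_format, of r]
  proof eventually_elim
    case (elim n)
    have "exp (real (m n) * ln (\<beta> n)) = \<beta> n ^ m n" using elim by (simp add: exp_of_nat_mult)
    also have "\<dots> = \<beta> n ^ (m n - r) * \<beta> n ^ r" using elim by (simp add: power_add[symmetric])
    finally show ?case using elim by (simp add: exp_add)
  qed
  ultimately have "((\<lambda>n. \<beta> n ^ (m n - r) * exp (real k * (real (m n) * q n))) \<longlongrightarrow> exp 0 / 1 ^ r) F"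
    by (rule Lim_transform_eventually)
  then show ?thesis by simp
qed

lemma null_power_tendsto:
  "((\<lambda>n. null_prob n (p n) k ^ (m n - r) * exp (real k * (real (m n) * q n))) \<longlongrightarrow> 1) F"
  by (rule power_tendsto[OF null_prob_approx[OF p']])

lemma null_pair_power_tendsto:
  "((\<lambda>n. (null_prob n (p n) 1 + pair_prob n (p n)) ^ (m n - r) * exp (real (m n) * q n)) \<longlongrightarrow> 1) F"
proof -
  have "\<bar>null_prob n (p n) 1 + pair_prob n (p n) - (1 - real 1 * q n)\<bar> \<le> 2 * (p n)\<^sup>2" for n
    using null_prob_approx[OF p', of n n 1] pair_prob_le[OF p', of n n] pair_prob_nonneg[OF p'(2), of n n]
    by simp
  from power_tendsto[OF this] show ?thesis by simp
qed

lemma m_pair_prob_tendsto: "((\<lambda>n. real (m n) * pair_prob n (p n)) \<longlongrightarrow> 0) F"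
  by (rule tendsto_sandwich[OF _ _ tendsto_const mp2_tendsto])
    (auto intro!: always_eventually mult_left_mono mult_nonneg_nonneg pair_prob_le p' pair_prob_nonneg)

section \<open>Limits of the probability, given the size of n m s\<close>

abbreviation "P n \<equiv> measure_pmf.prob (random_intersection_graph n (m n) (p n)) {G. min_degree G \<ge> 2}"

lemma exp_k_c: "\<forall>\<^sub>F n in F. exp (real k * c n) = exp (real k * (real (m n) * q n)) / (real n * a n) ^ k"
  using exp_c
proof eventually_elim
  case (elim n)
  show ?case unfolding exp_of_nat_mult elim by (simp add: power_divide)
qed

lemma n_pos: "\<forall>\<^sub>F n in F. 0 < n"
  by (rule ev_seq) (rule eventually_gt_at_top)

text \<open>Since \<open>exp (c n)\<close> is exp (m q) / n here, the error from vertices with a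
  single edge has normalised size n m s, which is assumed to vanish.\<close>

lemma isolated_limits:
  assumes a: "\<forall>\<^sub>F n in F. a n = 1"
    and nms: "((\<lambda>n. real n * (real (m n) * pair_prob n (p n))) \<longlongrightarrow> 0) F"
  shows "filterlim c at_bot F \<Longrightarrow> (P \<longlongrightarrow> 0) F"
    and "(c \<longlongrightarrow> c\<^sub>0) F \<Longrightarrow> (P \<longlongrightarrow> exp (- exp (- c\<^sub>0))) F"
    and "filterlim c at_top F \<Longrightarrow> (P \<longlongrightarrow> 1) F"
proof -
  let ?s = "\<lambda>n. pair_prob n (p n)"
  let ?R = "\<lambda>n. (real n)\<^sup>2 * (real (m n) * ?s n) * (null_prob n (p n) 1 + ?s n) ^ (m n - 1)"
  have lim: "((\<lambda>n. joint_sum (features n (m n) (p n)) {..<n} (isolated (m n)) k * exp (real k * c n))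
      \<longlongrightarrow> 1 / fact k) F" for k
  proof -
    have "((\<lambda>n. real (n choose k) / real n ^ k *
        (null_prob n (p n) k ^ (m n - 0) * exp (real k * (real (m n) * q n)))) \<longlongrightarrow> 1 / fact k * 1) F"
      by (intro tendsto_mult binomial_ratio_tendsto n_at_top null_power_tendsto)
    moreover have "\<forall>\<^sub>F n in F. real (n choose k) / real n ^ k *
        (null_prob n (p n) k ^ (m n - 0) * exp (real k * (real (m n) * q n))) =
        joint_sum (features n (m n) (p n)) {..<n} (isolated (m n)) k * exp (real k * c n)"
      using exp_k_c[of k] a by eventually_elim (simp add: joint_sum_isolated p')
    ultimately have "((\<lambda>n. joint_sum (features n (m n) (p n)) {..<n} (isolated (m n)) k * exp (real k * c n))
      \<longlongrightarrow> 1 / fact k * 1) F"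
      by (rule Lim_transform_eventually)
    then show ?thesis by simp
  qed
  have R: "((\<lambda>n. ?R n * exp (c n)) \<longlongrightarrow> 0) F"
  proof -
    have "((\<lambda>n. real n * (real (m n) * ?s n) *
       ((null_prob n (p n) 1 + ?s n) ^ (m n - 1) * exp (real (m n) * q n))) \<longlongrightarrow> 0 * 1) F"
      by (intro tendsto_mult nms null_pair_power_tendsto)
    moreover have "\<forall>\<^sub>F n in F. real n * (real (m n) * ?s n) *
       ((null_prob n (p n) 1 + ?s n) ^ (m n - 1) * exp (real (m n) * q n)) = ?R n * exp (c n)"
      using exp_c a n_pos by eventually_elim (simp add: power2_eq_square)
    ultimately have "((\<lambda>n. ?R n * exp (c n)) \<longlongrightarrow> 0 * 1) F"
      by (rule Lim_transform_eventually)
    then show ?thesis by simp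
  qed
  have upper: "\<forall>\<^sub>F n in F. P n \<le>
      measure_pmf.prob (features n (m n) (p n)) {H. \<forall>v\<in>{..<n}. \<not> isolated (m n) v H}"
    using n_pos by eventually_elim (rule prob_min_degree_le_isolated)
  have lower: "\<forall>\<^sub>F n in F.
      measure_pmf.prob (features n (m n) (p n)) {H. \<forall>v\<in>{..<n}. \<not> isolated (m n) v H} \<le> P n + ?R n"
    using n_pos by eventually_elim (rule prob_min_degree_ge_isolated[OF _ p'])
  have R0: "\<forall>\<^sub>F n in F. 0 \<le> ?R n"
    by (intro always_eventually allI mult_nonneg_nonneg zero_le_power add_nonneg_nonneg
      pair_prob_nonneg null_prob_nonneg p') auto
  note limits = bad_vertices_limit[where V = "\<lambda>n. {..<n}", OF _ lim measure_nonneg upper lower R0 R]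
  show "filterlim c at_bot F \<Longrightarrow> (P \<longlongrightarrow> 0) F" by (rule limits(1)) auto
  show "(c \<longlongrightarrow> c\<^sub>0) F \<Longrightarrow> (P \<longlongrightarrow> exp (- exp (- c\<^sub>0))) F" by (rule limits(2)) auto
  show "filterlim c at_top F \<Longrightarrow> (P \<longlongrightarrow> 1) F" by (rule limits(3)) auto
qed

text \<open>Since \<open>exp (c n)\<close> is exp (m q) / (n a), isolated vertices contribute 1 / a
  to the normalised error and doubly carried edges contribute m s. In the moments, image size
  \<open>r\<close> brings a factor (1 / (n a))^(k - r).\<close>

lemma pendant_limits:
  assumes a: "filterlim a at_top F"
    and nms: "((\<lambda>n. real n * (real (m n) * pair_prob n (p n)) / a n) \<longlongrightarrow> 1) F"
  shows "filterlim c at_bot F \<Longrightarrow> (P \<longlongrightarrow> 0) F"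
    and "(c \<longlongrightarrow> c\<^sub>0) F \<Longrightarrow> (P \<longlongrightarrow> exp (- exp (- c\<^sub>0))) F"
    and "filterlim c at_top F \<Longrightarrow> (P \<longlongrightarrow> 1) F"
proof -
  let ?s = "\<lambda>n. pair_prob n (p n)" and ?b = "\<lambda>n. null_prob n (p n)"
  let ?R = "\<lambda>n. real n * ?b n 1 ^ m n + (real n)\<^sup>2 * (real (m n) * ?s n)\<^sup>2 * (?b n 1 + ?s n) ^ (m n - 2)"
  let ?r = "\<lambda>n. real n * (real (m n) * ?s n) / a n"
  let ?e = "\<lambda>k n. exp (real k * (real (m n) * q n))"
  let ?J = "\<lambda>k n. joint_sum (features n (m n) (p n)) {..<n} (pendant (m n)) k"
  have inv_a: "((\<lambda>n. 1 / a n) \<longlongrightarrow> 0) F"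
    using tendsto_inverse_0_at_top[OF a] by (simp add: inverse_eq_divide)
  have inv_na: "((\<lambda>n. 1 / (real n * a n)) \<longlongrightarrow> 0) F"
  proof -
    have "((\<lambda>n. 1 / real n * (1 / a n)) \<longlongrightarrow> 0 * 0) F"
      by (intro tendsto_mult inv_a lim_seq) real_asymp
    then show ?thesis by simp
  qed
  have lim: "((\<lambda>n. ?J k n * exp (real k * c n)) \<longlongrightarrow> 1 / fact k) F" for k
  proof (rule tendsto_sandwich)
    let ?l = "\<lambda>n. real (n choose k) / real n ^ k * ((\<Prod>i<k. real (m n - i)) / real (m n) ^ k) *
      (real (n - k) / real n) ^ k * ?r n ^ k * (?b n k ^ (m n - k) * ?e k n)"
    let ?M = "\<lambda>r. if r = k then 1 else real (k ^ k)"
    let ?u = "\<lambda>n. real (n choose k) / real n ^ k *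
      (\<Sum>r\<le>k. ?M r * ?r n ^ r * (1 / (real n * a n)) ^ (k - r) * (?b n k ^ (m n - r) * ?e k n))"
    have "(?l \<longlongrightarrow> 1 / fact k * 1 * 1 ^ k * 1 ^ k * 1) F"
    proof (intro tendsto_mult tendsto_power binomial_ratio_tendsto n_at_top null_power_tendsto nms
        falling_factorial_ratio_tendsto m_at_top)
      show "((\<lambda>n. real (n - k) / real n) \<longlongrightarrow> 1) F" by (rule lim_seq) real_asymp
    qed
    then show "(?l \<longlongrightarrow> 1 / fact k) F" by simp
    have "(?u \<longlongrightarrow> 1 / fact k * (\<Sum>r\<le>k. ?M r * 1 ^ r * 0 ^ (k - r) * 1)) F"
      by (intro tendsto_mult tendsto_sum tendsto_power tendsto_const binomial_ratio_tendsto n_at_top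
        null_power_tendsto nms inv_na)
    \<comment> \<open>As \<open>0 ^ 0 = 1\<close>, only \<open>r = k\<close> survives, where
      \<open>?M\<close> is 1; the crude constant for the other functions disappears.\<close>
    moreover have "(\<Sum>r\<le>k. ?M r * 1 ^ r * 0 ^ (k - r) * 1) = (\<Sum>r\<in>{k}. ?M r * 1 ^ r * 0 ^ (k - r) * 1)"
      by (rule sum.mono_neutral_right) (auto simp: power_0_left)
    ultimately show "(?u \<longlongrightarrow> 1 / fact k) F" by simp
    show "\<forall>\<^sub>F n in F. ?l n \<le> ?J k n * exp (real k * c n)"
      using exp_k_c[of k] n_pos m_pos a_pos
    proof eventually_elim
      case (elim n)
      have "?l n = real (n choose k) * ((\<Prod>i<k. real (m n - i)) * (real (n - k) * ?s n) ^ k *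
          ?b n k ^ (m n - k)) * exp (real k * c n)"
        unfolding elim(1) using elim(2-4)
        by (simp add: power_mult_distrib power_divide field_simps)
      also have "\<dots> \<le> ?J k n * exp (real k * c n)"
        by (intro mult_right_mono joint_sum_pendant_ge p') auto
      finally show ?case .
    qed
    show "\<forall>\<^sub>F n in F. ?J k n * exp (real k * c n) \<le> ?u n"
      using exp_k_c[of k] n_pos a_pos
    proof eventually_elim
      case (elim n)
      define y where "y = real n * a n"
      have y: "y > 0" using elim by (simp add: y_def)
      have n: "(real n)\<^sup>2 * real (m n) * ?s n = ?r n * y"
        using elim by (simp add: y_def power2_eq_square)
      have sum_eq: "(\<Sum>r\<le>k. ?M r * (?r n * y) ^ r * ?b n k ^ (m n - r) * (?e k n / y ^ k)) =
          (\<Sum>r\<le>k. ?M r * ?r n ^ r * (1 / y) ^ (k - r) * (?b n k ^ (m n - r) * ?e k n))"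
      proof (rule sum.cong[OF refl])
        fix r assume "r \<in> {..k}"
        then have "y ^ k = y ^ r * y ^ (k - r)" by (simp add: power_add[symmetric])
        then have y_pow: "(1 / y) ^ (k - r) = y ^ r / y ^ k" using y by (simp add: power_divide)
        show "?M r * (?r n * y) ^ r * ?b n k ^ (m n - r) * (?e k n / y ^ k) =
          ?M r * ?r n ^ r * (1 / y) ^ (k - r) * (?b n k ^ (m n - r) * ?e k n)"
          unfolding y_pow power_mult_distrib[of "?r n" y r] by (simp only: divide_inverse mult_ac)
      qed
      have "?J k n * exp (real k * c n) \<le>
        real (n choose k) * ((\<Sum>r\<le>k. ?M r * ((real n)\<^sup>2 * real (m n) * ?s n) ^ r * ?b n k ^ (m n - r)) / real n ^ k)
         * exp (real k * c n)"
        by (intro mult_right_mono joint_sum_pendant_le p' elim) auto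
      also have "\<dots> = real (n choose k) / real n ^ k *
          (\<Sum>r\<le>k. ?M r * (?r n * y) ^ r * ?b n k ^ (m n - r) * (?e k n / y ^ k))"
        unfolding elim(1) n y_def[symmetric] sum_distrib_right[symmetric] by simp
      finally show ?case unfolding sum_eq unfolding y_def .
    qed
  qed
  have R: "((\<lambda>n. ?R n * exp (c n)) \<longlongrightarrow> 0) F"
  proof -
    have "((\<lambda>n. 1 / a n * (?b n 1 ^ (m n - 0) * ?e 1 n) +
       ?r n * (real (m n) * ?s n) * ((?b n 1 + ?s n) ^ (m n - 2) * exp (real (m n) * q n))) \<longlongrightarrow> 0 * 1 + 1 * 0 * 1) F"
      by (intro tendsto_add tendsto_mult inv_a nms m_pair_prob_tendsto null_pair_power_tendsto null_power_tendsto)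
    moreover have "\<forall>\<^sub>F n in F. 1 / a n * (?b n 1 ^ (m n - 0) * ?e 1 n) +
       ?r n * (real (m n) * ?s n) * ((?b n 1 + ?s n) ^ (m n - 2) * exp (real (m n) * q n)) = ?R n * exp (c n)"
      using exp_c n_pos a_pos
    proof eventually_elim
      case (elim n)
      show ?case unfolding elim(1) using elim(2,3) by (simp add: power2_eq_square field_simps)
    qed
    ultimately have "((\<lambda>n. ?R n * exp (c n)) \<longlongrightarrow> 0 * 1 + 1 * 0 * 1) F"
      by (rule Lim_transform_eventually)
    then show ?thesis by simp
  qed
  have upper: "\<forall>\<^sub>F n in F. P n \<le>
      measure_pmf.prob (features n (m n) (p n)) {H. \<forall>v\<in>{..<n}. \<not> pendant (m n) v H}"
    using n_pos by eventually_elim (rule prob_min_degree_le_pendant)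
  have lower: "\<forall>\<^sub>F n in F.
      measure_pmf.prob (features n (m n) (p n)) {H. \<forall>v\<in>{..<n}. \<not> pendant (m n) v H} \<le> P n + ?R n"
    using n_pos by eventually_elim (rule prob_min_degree_ge_pendant[OF _ p'])
  have R0: "\<forall>\<^sub>F n in F. 0 \<le> ?R n"
    by (intro always_eventually allI mult_nonneg_nonneg zero_le_power add_nonneg_nonneg
      pair_prob_nonneg null_prob_nonneg p') auto
  note limits = bad_vertices_limit[where V = "\<lambda>n. {..<n}", OF _ lim measure_nonneg upper lower R0 R]
  show "filterlim c at_bot F \<Longrightarrow> (P \<longlongrightarrow> 0) F" by (rule limits(1)) auto
  show "(c \<longlongrightarrow> c\<^sub>0) F \<Longrightarrow> (P \<longlongrightarrow> exp (- exp (- c\<^sub>0))) F" by (rule limits(2)) auto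
  show "filterlim c at_top F \<Longrightarrow> (P \<longlongrightarrow> 1) F" by (rule limits(3)) auto
qed

section \<open>The size of n m s in the two ranges of m\<close>

text \<open>With x = n p, the quantity is about x (m p) exp (-x). Here m p = O(ln n), and few
  features force x >= (1 + \<epsilon>/2) ln ln n, which leaves a negative power of ln n.\<close>

lemma few_features_pairs_tendsto:
  assumes eps: "\<epsilon> > 0" and few: "\<forall>\<^sub>F n in F. real (m n) < (1 - \<epsilon>) * feature_threshold n"
  shows "((\<lambda>n. real n * (real (m n) * pair_prob n (p n))) \<longlongrightarrow> 0) F"
proof -
  \<comment> \<open>A share \<eta> of the exponent pays for the factor x, through x <= exp (\<eta>
    x) / \<eta>. The choice keeps the exponent 1 + \<epsilon>/4 > 1 for ln n.\<close>
  define \<eta> where "\<eta> = (\<epsilon> / 4) / (1 + \<epsilon> / 2)"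
  have \<eta>: "\<eta> > 0" using eps by (simp add: \<eta>_def)
  have \<eta>1: "\<eta> < 1" using eps by (simp add: \<eta>_def field_simps)
  have \<eta>_eq: "(1 - \<eta>) * (1 + \<epsilon> / 2) = 1 + \<epsilon> / 4"
    using eps by (simp add: \<eta>_def field_simps)
  let ?L = "\<lambda>n. ln (real n)"
  have ratio: "(1 + \<epsilon> / 2) / (1 + \<epsilon>) < 1" using eps by simp
  have mq_lo: "\<forall>\<^sub>F n in F. (1 + \<epsilon> / 2) / (1 + \<epsilon>) < real (m n) * q n / ?L n"
    by (rule order_tendstoD(1)[OF mq ratio])
  have mq_hi: "\<forall>\<^sub>F n in F. real (m n) * q n / ?L n < 2"
    by (rule order_tendstoD(2)[OF mq]) simp
  \<comment> \<open>The 4 comes from m p <= 4 ln n, and exp 2 from the exponent \<open>n - 2\<close>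
    in place of \<open>n\<close>.\<close>
  let ?B = "\<lambda>n. 4 * exp 2 / \<eta> * exp (- (\<epsilon> / 4) * ln (?L n))"
  have "(?B \<longlongrightarrow> 0) F" using eps \<eta> by (intro lim_seq) real_asymp
  then show ?thesis
  proof (rule tendsto_sandwich[OF _ _ tendsto_const, rotated 2])
    show "\<forall>\<^sub>F n in F. 0 \<le> real n * (real (m n) * pair_prob n (p n))"
      by (simp add: pair_prob_nonneg p')
    show "\<forall>\<^sub>F n in F. real n * (real (m n) * pair_prob n (p n)) \<le> ?B n"
      using few mq_lo mq_hi m_pos ln_pos ev_seq[OF eventually_ge_at_top[of 2]]
        ev_seq[OF ln_ln_ge_1]
    proof eventually_elim
      case (elim n)
      define L l x where "L = ?L n" and "l = ln L" and "x = real n * p n"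
      have L: "L > 0" and l: "l \<ge> 1" and mp: "real (m n) > 0" and n: "n \<ge> 2"
        using elim by (auto simp: L_def l_def)
      have x0: "x > 0" using n p[of n] by (simp add: x_def)
      have few': "real (m n) * l < (1 - \<epsilon>) * (real n * L)"
        using elim(1) l by (simp add: feature_threshold_def L_def l_def field_simps)
      have "0 < (1 - \<epsilon>) * (real n * L)" using few' mp l by (smt (verit) mult_pos_pos)
      moreover have "0 < real n * L" using L n by simp
      ultimately have eps1: "1 - \<epsilon> > 0" by (simp only: zero_less_mult_pos2)
      \<comment> \<open>1 - \<epsilon> is traded for 1 / (1 + \<epsilon>) by means of (1 +
        \<epsilon>) (1 - \<epsilon>) <= 1.\<close>
      have few2: "(1 + \<epsilon>) * (real (m n) * l) \<le> real n * L"
      proof -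
        have "(1 + \<epsilon>) * (real (m n) * l) \<le> (1 + \<epsilon>) * ((1 - \<epsilon>) * (real n * L))"
          using few' eps by (intro mult_left_mono) auto
        also have "\<dots> = (1 - \<epsilon>\<^sup>2) * (real n * L)" by (simp add: algebra_simps power2_eq_square)
        also have "\<dots> \<le> 1 * (real n * L)" using L by (intro mult_right_mono) auto
        finally show ?thesis by simp
      qed
      \<comment> \<open>By q <= p, x is at least (m q) (n / m), where m q is nearly L and n / m is
        at least (1 + \<epsilon>) l / L.\<close>
      have x_ge: "(1 + \<epsilon> / 2) * l \<le> x"
      proof -
        have "(1 + \<epsilon> / 2) * L \<le> (1 + \<epsilon>) * (real (m n) * q n)"
          using elim(2) eps L by (simp add: L_def[symmetric] field_simps)
        then have "l * real n * ((1 + \<epsilon> / 2) * L) \<le> l * real n * ((1 + \<epsilon>) * (real (m n) * q n))"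
          using l by (intro mult_left_mono) auto
        also have "\<dots> = ((1 + \<epsilon>) * (real (m n) * l)) * (real n * q n)" by (simp add: mult_ac)
        also have "\<dots> \<le> (real n * L) * (real n * q n)"
          using few2 useful_prob_bounds(1)[OF p'] by (intro mult_right_mono) auto
        also have "\<dots> \<le> (real n * L) * x"
          unfolding x_def using useful_prob_bounds(2)[OF p', of n n] L by (intro mult_left_mono) auto
        finally have "(real n * L) * ((1 + \<epsilon> / 2) * l) \<le> (real n * L) * x" by (simp add: mult_ac)
        then show ?thesis using L n by simp
      qed
      have mp_le: "real (m n) * p n \<le> 4 * L"
      proof -
        have "real (m n) * x \<le> real (m n) * (real n * q n + 2)"
          unfolding x_def using n by (intro mult_left_mono p_le_useful_prob p') auto
        also have "\<dots> = real n * (real (m n) * q n) + 2 * real (m n)" by (simp add: algebra_simps)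
        also have "\<dots> \<le> real n * (2 * L) + 2 * (real n * L)"
        proof (intro add_mono mult_left_mono)
          show "real (m n) * q n \<le> 2 * L" using elim(3) L by (simp add: L_def[symmetric] field_simps)
          have "real (m n) \<le> real (m n) * l" using l mp by simp
          also have "\<dots> \<le> (1 + \<epsilon>) * (real (m n) * l)" using eps mp l by simp
          also note few2
          finally show "real (m n) \<le> real n * L" .
        qed auto
        finally have "real n * (real (m n) * p n) \<le> real n * (4 * L)" by (simp add: x_def algebra_simps)
        then show ?thesis using n by simp
      qed
      have pow: "(1 - p n) ^ (n - 2) \<le> exp 2 * exp (- x)"
      proof -
        have "(1 - p n) ^ (n - 2) \<le> exp (- (p n * real (n - 2)))"
          by (rule power_one_minus_le_exp) (rule p')
        also have "\<dots> \<le> exp (2 - x)"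
          using n p'[of n] by (simp add: x_def of_nat_diff algebra_simps)
        finally show ?thesis by (simp add: exp_diff exp_minus divide_inverse)
      qed
      have x_exp: "x * exp (- x) \<le> 1 / \<eta> * exp (- ((1 + \<epsilon> / 4) * l))"
      proof -
        have "\<eta> * x \<le> exp (\<eta> * x)" using exp_ge_add_one_self[of "\<eta> * x"] by linarith
        then have "x \<le> 1 / \<eta> * exp (\<eta> * x)" using \<eta> by (simp add: field_simps)
        then have "x * exp (- x) \<le> (1 / \<eta> * exp (\<eta> * x)) * exp (- x)"
          by (rule mult_right_mono) simp
        also have "\<dots> = 1 / \<eta> * exp (- ((1 - \<eta>) * x))"
          by (simp add: exp_add[symmetric] algebra_simps)
        also have "(1 + \<epsilon> / 4) * l \<le> (1 - \<eta>) * x"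
          unfolding \<eta>_eq[symmetric] mult.assoc using x_ge \<eta>1 by (intro mult_left_mono) auto
        then have "1 / \<eta> * exp (- ((1 - \<eta>) * x)) \<le> 1 / \<eta> * exp (- ((1 + \<epsilon> / 4) * l))"
          using \<eta> by (intro mult_left_mono) auto
        finally show ?thesis .
      qed
      have "real n * (real (m n) * pair_prob n (p n)) = x * (real (m n) * p n) * (1 - p n) ^ (n - 2)"
        by (simp add: pair_prob_def x_def power2_eq_square)
      also have "\<dots> \<le> x * (4 * L) * (exp 2 * exp (- x))"
        using x0 L p'[of n] by (intro mult_mono pow mp_le mult_left_mono) auto
      also have "\<dots> = 4 * exp 2 * L * (x * exp (- x))" by simp
      also have "\<dots> \<le> 4 * exp 2 * L * (1 / \<eta> * exp (- ((1 + \<epsilon> / 4) * l)))"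
        using L by (intro mult_left_mono x_exp) auto
      also have "L = exp l" using L by (simp add: l_def)
      also have "4 * exp 2 * exp l * (1 / \<eta> * exp (- ((1 + \<epsilon> / 4) * l))) = 4 * exp 2 / \<eta> * exp (- (\<epsilon> / 4) * l)"
        by (simp add: exp_add[symmetric] algebra_simps)
      finally show ?case unfolding l_def L_def .
    qed
  qed
qed

text \<open>Many features force x = n p <= (1 - d) ln ln n + 2, so that a >= ln n exp (-x) is at
  least a constant times (ln n)^d. For the ratio, (1 - p)^(n-2) and (1 - p)^(n-1) are replaced by
  exp (-x) with small relative errors.\<close>

lemma many_features_limits:
  assumes eps: "\<epsilon> > 0" and many: "\<forall>\<^sub>F n in F. (1 + \<epsilon>) * feature_threshold n < real (m n)"
    and a: "\<forall>\<^sub>F n in F. a n = real n * p n * ln (real n) / (exp (real n * p n) - 1)"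
  shows "filterlim a at_top F"
    and "((\<lambda>n. real n * (real (m n) * pair_prob n (p n)) / a n) \<longlongrightarrow> 1) F"
proof -
  let ?L = "\<lambda>n. ln (real n)" and ?x = "\<lambda>n. real n * p n"
  \<comment> \<open>\<open>d\<close> is the slack left when m q is allowed to reach (1 +
    \<epsilon>/2) ln n while m exceeds (1 + \<epsilon>) times the threshold.\<close>
  define d where "d = (\<epsilon> / 2) / (1 + \<epsilon>)"
  have d: "d > 0" and d_eq: "(1 - d) * (1 + \<epsilon>) = 1 + \<epsilon> / 2"
    using eps by (auto simp: d_def field_simps)
  have mq_hi: "\<forall>\<^sub>F n in F. real (m n) * q n / ?L n < 1 + \<epsilon> / 2"
    by (rule order_tendstoD(2)[OF mq]) (use eps in simp)
  show "filterlim a at_top F"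
  proof (rule filterlim_at_top_mono)
    have "filterlim (\<lambda>n. exp (d * ln (?L n) - 2)) at_top sequentially" using d by real_asymp
    then show "filterlim (\<lambda>n. exp (d * ln (?L n) - 2)) at_top F"
      using F by (rule filterlim_mono[OF _ order_refl])
    show "\<forall>\<^sub>F n in F. exp (d * ln (?L n) - 2) \<le> a n"
      using many mq_hi a m_pos ln_pos ev_seq[OF ln_ln_ge_1] ev_seq[OF eventually_ge_at_top[of 2]]
    proof eventually_elim
      case (elim n)
      define L l x where "L = ?L n" and "l = ln L" and "x = ?x n"
      have L: "L > 0" and l: "l \<ge> 1" and mp: "real (m n) > 0" and n: "n \<ge> 2"
        using elim by (auto simp: L_def l_def)
      have x0: "x > 0" using n p[of n] by (simp add: x_def)
      have many': "(1 + \<epsilon>) * (real n * L) < real (m n) * l"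
        using elim(1) l by (simp add: feature_threshold_def L_def l_def field_simps)
      have "(1 + \<epsilon>) * (real n * L) * q n \<le> real (m n) * l * q n"
        using many' useful_prob_bounds(1)[OF p'] by (intro mult_right_mono) auto
      also have "\<dots> = l * (real (m n) * q n)" by simp
      also have "\<dots> \<le> l * ((1 + \<epsilon> / 2) * L)"
        using elim(2) l L by (intro mult_left_mono) (auto simp: L_def[symmetric] field_simps)
      also have "\<dots> = (1 + \<epsilon>) * L * ((1 - d) * l)" unfolding d_eq[symmetric] by simp
      finally have "(1 + \<epsilon>) * L * (real n * q n) \<le> (1 + \<epsilon>) * L * ((1 - d) * l)" by (simp add: mult_ac)
      then have "real n * q n \<le> (1 - d) * l" using eps L by simp
      then have x_le: "x \<le> (1 - d) * l + 2"
        using p_le_useful_prob[OF p', of n n] n by (simp add: x_def)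
      have "exp (d * l - 2) = exp l * exp (- ((1 - d) * l + 2))"
        by (simp add: exp_add[symmetric] algebra_simps)
      also have "\<dots> \<le> exp l * exp (- x)" using x_le by simp
      also have "\<dots> \<le> L * (x / (exp x - 1))"
        using mult_left_mono[OF x_over_exp_minus_1_bounds(2)[OF x0], of L] L by (simp add: l_def)
      also have "\<dots> = a n" using elim(3) by (simp add: L_def x_def mult_ac)
      finally show ?case by (simp add: l_def L_def)
    qed
  qed
  \<comment> \<open>Thus n p^2 inherits the limit 0 from m p^2, which permits replacing (1 - p)^n by
    exp (-n p).\<close>
  have nm: "\<forall>\<^sub>F n in F. real n \<le> real (m n)"
  proof -
    have "\<forall>\<^sub>F n in sequentially. real n \<le> feature_threshold n"
      unfolding feature_threshold_def by real_asymp
    from ev_seq[OF this] many show ?thesis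
    proof eventually_elim
      case (elim n)
      then have "feature_threshold n \<le> (1 + \<epsilon>) * feature_threshold n"
        using eps by (simp add: mult_le_cancel_right1)
      with elim show ?case by linarith
    qed
  qed
  let ?\<tau> = "\<lambda>n. 2 * real n * (p n)\<^sup>2 + 2 * p n"
  have \<tau>_lim: "(?\<tau> \<longlongrightarrow> 0) F"
  proof (rule tendsto_sandwich[OF _ _ tendsto_const])
    show "\<forall>\<^sub>F n in F. 0 \<le> ?\<tau> n" using p' by simp
    show "\<forall>\<^sub>F n in F. ?\<tau> n \<le> 2 * (real (m n) * (p n)\<^sup>2) + 2 * p n"
      using nm by eventually_elim (simp add: mult_right_mono)
    have "((\<lambda>n. 2 * (real (m n) * (p n)\<^sup>2) + 2 * p n) \<longlongrightarrow> 2 * 0 + 2 * 0) F"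
      by (intro tendsto_add tendsto_mult tendsto_const mp2_tendsto p_tendsto)
    then show "((\<lambda>n. 2 * (real (m n) * (p n)\<^sup>2) + 2 * p n) \<longlongrightarrow> 0) F" by simp
  qed
  have \<tau>_small: "\<forall>\<^sub>F n in F. ?\<tau> n < 1 / 2"
    by (rule order_tendstoD(2)[OF \<tau>_lim]) simp
  have pow: "\<bar>(1 - p n) ^ (n - j) * exp (?x n) - 1\<bar> \<le> 2 * (2 * real n * (p n)\<^sup>2 + real j * p n)"
    if "?\<tau> n < 1 / 2" "j \<le> 2" "2 \<le> n" for n j
  proof -
    have "0 \<le> real n * (p n)\<^sup>2" by simp
    then have "p n \<le> 1 / 2" using that(1) by linarith
    from power_one_minus_exp_form[OF p'(1) this, of j n] that obtain t where
      t: "(1 - p n) ^ (n - j) * exp (?x n) = exp t" "\<bar>t\<bar> \<le> 2 * real n * (p n)\<^sup>2 + real j * p n" by auto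
    have "real j * p n \<le> 2 * p n" using that p' by (intro mult_right_mono) auto
    then have "\<bar>t\<bar> \<le> 1 / 2" using t(2) that(1) by linarith
    from abs_exp_minus_1_le[OF this] t show ?thesis by simp
  qed
  have A: "((\<lambda>n. (1 - p n) ^ (n - 2) * exp (?x n)) \<longlongrightarrow> 1) F"
  proof -
    have "((\<lambda>n. (1 - p n) ^ (n - 2) * exp (?x n) - 1) \<longlongrightarrow> 0) F"
    proof (rule Lim_null_comparison)
      show "\<forall>\<^sub>F n in F. norm ((1 - p n) ^ (n - 2) * exp (?x n) - 1) \<le> 2 * ?\<tau> n"
        using \<tau>_small ev_seq[OF eventually_ge_at_top[of 2]]
        by eventually_elim (use pow[where j = 2] in simp)
      show "((\<lambda>n. 2 * ?\<tau> n) \<longlongrightarrow> 0) F" using tendsto_mult[OF tendsto_const \<tau>_lim, of 2] by simp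
    qed
    then show ?thesis using LIM_zero_iff by blast
  qed
  \<comment> \<open>Both numerator and denominator may tend to 0, since n p may. The factor u / (1 -
    u) <= 1 / x divides the error 4 n p^2 + 2 p by n p, leaving 4 p + 2 / n.\<close>
  have B: "((\<lambda>n. (1 - (1 - p n) ^ (n - 1)) / (1 - exp (- ?x n))) \<longlongrightarrow> 1) F"
  proof -
    have "((\<lambda>n. (1 - (1 - p n) ^ (n - 1)) / (1 - exp (- ?x n)) - 1) \<longlongrightarrow> 0) F"
    proof (rule Lim_null_comparison)
      have "((\<lambda>n. 4 * p n + 2 / real n) \<longlongrightarrow> 4 * 0 + 0) F"
        by (intro tendsto_add tendsto_mult tendsto_const p_tendsto lim_seq) real_asymp
      then show "((\<lambda>n. 4 * p n + 2 / real n) \<longlongrightarrow> 0) F" by simp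
      show "\<forall>\<^sub>F n in F. norm ((1 - (1 - p n) ^ (n - 1)) / (1 - exp (- ?x n)) - 1) \<le> 4 * p n + 2 / real n"
        using \<tau>_small ev_seq[OF eventually_ge_at_top[of 2]]
      proof eventually_elim
        case (elim n)
        define x u w where "x = ?x n" and "u = exp (- x)" and "w = (1 - p n) ^ (n - 1)"
        have x0: "x > 0" using elim(2) p[of n] by (simp add: x_def)
        have u: "0 < u" "u < 1" "u * exp x = 1" using x0 by (simp_all add: u_def exp_add[symmetric])
        have w_u: "w - u = u * (w * exp x - 1)" using u(3) by (simp add: algebra_simps)
        have "(1 - w) / (1 - u) - 1 = - ((w - u) / (1 - u))" using u(2) by (simp add: field_simps)
        then have "(1 - w) / (1 - u) - 1 = - (u / (1 - u) * (w * exp x - 1))" unfolding w_u by simp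
        then have "\<bar>(1 - w) / (1 - u) - 1\<bar> = u / (1 - u) * \<bar>w * exp x - 1\<bar>"
          using u by (simp add: abs_mult)
        also have "\<dots> \<le> 1 / x * (2 * (2 * real n * (p n)\<^sup>2 + real 1 * p n))"
          using x_over_exp_minus_1_bounds(3)[OF x0] pow[OF elim(1) _ elim(2), of 1] x0
          unfolding u_def w_def x_def by (intro mult_mono) auto
        also have "\<dots> = 4 * p n + 2 / real n"
          using elim(2) p[of n] by (simp add: x_def field_simps power2_eq_square)
        finally show ?case by (simp add: w_def u_def x_def)
      qed
    qed
    then show ?thesis using LIM_zero_iff by blast
  qed
  \<comment> \<open>The factor 1 - (1 - p)^(n-1) inside q cancels, and exp x (1 - exp (-x)) = exp x
    - 1 reproduces the denominator of a.\<close>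
  have "((\<lambda>n. (real (m n) * q n / ?L n) * ((1 - p n) ^ (n - 2) * exp (?x n)) /
      ((1 - (1 - p n) ^ (n - 1)) / (1 - exp (- ?x n)))) \<longlongrightarrow> 1 * 1 / 1) F"
    by (intro tendsto_mult tendsto_divide mq A B) auto
  moreover have "\<forall>\<^sub>F n in F. (real (m n) * q n / ?L n) * ((1 - p n) ^ (n - 2) * exp (?x n)) /
      ((1 - (1 - p n) ^ (n - 1)) / (1 - exp (- ?x n))) = real n * (real (m n) * pair_prob n (p n)) / a n"
    using a ln_pos ev_seq[OF eventually_ge_at_top[of 2]]
  proof eventually_elim
    case (elim n)
    define x L w where "x = ?x n" and "L = ?L n" and "w = (1 - p n) ^ (n - 1)"
    have x0: "x > 0" using elim p[of n] by (simp add: x_def)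
    have ex: "exp x > 1" using x0 by simp
    have w: "w < 1" unfolding w_def using elim p[of n] by (intro power_Suc_less_one | simp add: power_less_one_iff)+
    have "(real (m n) * (p n * (1 - w)) / L) * ((1 - p n) ^ (n - 2) * exp x) / ((1 - w) / (1 - exp (- x)))
      = real (m n) * p n / L * (1 - p n) ^ (n - 2) * (exp x * (1 - exp (- x)))"
      using w by simp
    also have "exp x * (1 - exp (- x)) = exp x - 1" by (simp add: algebra_simps exp_minus)
    also have "real (m n) * p n / L * (1 - p n) ^ (n - 2) * (exp x - 1)
      = real n * (real (m n) * pair_prob n (p n)) / (x * L / (exp x - 1))"
      using ex x0 elim by (simp add: pair_prob_def x_def power2_eq_square)
    finally show ?case using elim(1) by (simp add: useful_prob_def w_def x_def L_def)
  qed
  ultimately have "((\<lambda>n. real n * (real (m n) * pair_prob n (p n)) / a n) \<longlongrightarrow> 1 * 1 / 1) F"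
    by (rule Lim_transform_eventually)
  then show "((\<lambda>n. real n * (real (m n) * pair_prob n (p n)) / a n) \<longlongrightarrow> 1) F" by simp
qed

end

section \<open>Entering the two regimes and combining them\<close>

text \<open>This breaks the circularity that a depends on p, which is known only through an equation
  containing a. The bound a <= ln n holds for every p, hence m q <= 2 ln n, hence n p <= 2 ln ln n +
  2, and this bounds ln a from below.\<close>

lemma ln_correction_tendsto:
  fixes m :: "nat \<Rightarrow> nat" and p c a :: "nat \<Rightarrow> real"
  assumes F: "F \<le> sequentially" and eps: "\<epsilon> > 0"
    and p: "\<And>n. 0 < p n" "\<And>n. p n < 1"
    and many: "\<forall>\<^sub>F n in F. (1 + \<epsilon>) * feature_threshold n < real (m n)"
    and a: "\<forall>\<^sub>F n in F. a n = real n * p n * ln (real n) / (exp (real n * p n) - 1)"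
    and eq: "\<forall>\<^sub>F n in F. real (m n) * useful_prob n (p n) = ln (real n) + ln (a n) + c n"
    and c: "((\<lambda>n. c n / ln (real n)) \<longlongrightarrow> 0) F"
  shows "((\<lambda>n. ln (a n) / ln (real n)) \<longlongrightarrow> 0) F"
proof (rule Lim_null_comparison)
  let ?L = "\<lambda>n. ln (real n)"
  have ev: "eventually Q sequentially \<Longrightarrow> eventually Q F" for Q
    using F by (rule filter_leD)
  show "((\<lambda>n. (ln (?L n) + 2) / ?L n) \<longlongrightarrow> 0) F"
    by (rule tendsto_mono[OF F]) real_asymp
  have c_hi: "\<forall>\<^sub>F n in F. c n / ?L n < 1 / 2"
    by (rule order_tendstoD(2)[OF c]) simp
  have lnln: "\<forall>\<^sub>F n in sequentially. ln (?L n) \<le> ?L n / 2" by real_asymp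
  show "\<forall>\<^sub>F n in F. norm (ln (a n) / ?L n) \<le> (ln (?L n) + 2) / ?L n"
    using many a eq c_hi ev[OF lnln] ev[OF ln_ln_ge_1] ev[OF eventually_ge_at_top[of 2]]
  proof eventually_elim
    case (elim n)
    define L l x where "L = ?L n" and "l = ln L" and "x = real n * p n"
    have n: "n \<ge> 2" and l: "l \<ge> 1" using elim by (auto simp: L_def l_def)
    have L: "L > 0" using n by (simp add: L_def)
    have x0: "x > 0" using n p(1)[of n] by (simp add: x_def)
    have p': "0 \<le> p n" "p n \<le> 1" using p[of n] by auto
    have a_eq: "a n = L * (x / (exp x - 1))" using elim(2) by (simp add: L_def x_def mult_ac)
    have a_le: "a n \<le> L"
      using mult_left_mono[OF x_over_exp_minus_1_bounds(1)[OF x0], of L] L by (simp add: a_eq)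
    have a_ge: "L * exp (- x) \<le> a n"
      using mult_left_mono[OF x_over_exp_minus_1_bounds(2)[OF x0], of L] L by (simp add: a_eq)
    have a0: "a n > 0" by (rule less_le_trans[OF _ a_ge]) (use L in simp)
    have ln_le: "ln (a n) \<le> l" using a_le a0 L by (simp add: l_def)
    have "ln (L * exp (- x)) \<le> ln (a n)" using a_ge a0 L by (intro ln_mono) auto
    then have ln_ge: "l - x \<le> ln (a n)" using L by (simp add: l_def ln_mult)
    have mq: "real (m n) * useful_prob n (p n) \<le> 2 * L"
    proof -
      have "c n \<le> L / 2" using elim(4) L by (simp add: L_def[symmetric] field_simps)
      moreover have "l \<le> L / 2" using elim(5) by (simp add: l_def L_def)
      ultimately show ?thesis using elim(3) ln_le unfolding L_def[symmetric] by linarith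
    qed
    have thr: "real n * L \<le> real (m n) * l"
    proof -
      have "(1 + \<epsilon>) * (real n * L) < real (m n) * l"
        using elim(1) l by (simp add: feature_threshold_def L_def l_def field_simps)
      moreover have "1 * (real n * L) \<le> (1 + \<epsilon>) * (real n * L)"
        using eps L by (intro mult_right_mono) auto
      ultimately show ?thesis by linarith
    qed
    have "real n * L * useful_prob n (p n) \<le> real (m n) * l * useful_prob n (p n)"
      using thr useful_prob_bounds(1)[OF p'] by (intro mult_right_mono) auto
    also have "\<dots> = l * (real (m n) * useful_prob n (p n))" by simp
    also have "\<dots> \<le> l * (2 * L)" using l mq by (intro mult_left_mono) auto
    finally have "L * (real n * useful_prob n (p n)) \<le> L * (2 * l)" by (simp add: mult_ac)
    then have "real n * useful_prob n (p n) \<le> 2 * l" using L by simp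
    then have "x \<le> 2 * l + 2" using p_le_useful_prob[OF p', of n] n by (simp add: x_def)
    then have "\<bar>ln (a n)\<bar> \<le> l + 2" using ln_le ln_ge l by (simp add: abs_le_iff)
    then show ?case using L by (simp add: L_def[symmetric] l_def divide_right_mono)
  qed
qed

lemma tendsto_split_principal:
  assumes "(f \<longlongrightarrow> l) (inf F (principal {x. Q x}))" "(f \<longlongrightarrow> l) (inf F (principal {x. \<not> Q x}))"
  shows "(f \<longlongrightarrow> l) F"
proof (rule topological_tendstoI)
  fix S assume "open S" "l \<in> S"
  with assms have "\<forall>\<^sub>F x in inf F (principal {x. Q x}). f x \<in> S"
    "\<forall>\<^sub>F x in inf F (principal {x. \<not> Q x}). f x \<in> S" by (auto dest: topological_tendstoD)
  then show "\<forall>\<^sub>F x in F. f x \<in> S"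
    unfolding eventually_inf_principal by eventually_elim auto
qed

theorem theorem2:
  fixes m :: "nat \<Rightarrow> nat" and p c :: "nat \<Rightarrow> real" and \<epsilon> :: real
  assumes p: "\<And>n. 0 < p n \<and> p n < 1"
    and m: "(\<lambda>n. (ln (real n))\<^sup>2) \<in> o(\<lambda>n. real (m n))"
    and eps: "\<epsilon> > 0"
    and dichotomy: "\<forall>\<^sub>F n in sequentially.
          real (m n) < (1 - \<epsilon>) * feature_threshold n \<or>
          real (m n) > (1 + \<epsilon>) * feature_threshold n"
    and eq: "\<forall>\<^sub>F n in sequentially.
          p n * (1 - (1 - p n) ^ (n - 1)) =
          (ln (real n) + ln (degree_correction \<epsilon> n (m n) (p n)) + c n) / real (m n)"
    and c: "c \<in> o(\<lambda>n. ln (real n))"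
  defines "P \<equiv> \<lambda>n. measure_pmf.prob (random_intersection_graph n (m n) (p n))
                      {G. min_degree G \<ge> 2}"
  shows "(filterlim c at_bot sequentially \<longrightarrow> P \<longlonglongrightarrow> 0) \<and>
         (\<forall>c\<^sub>0. c \<longlonglongrightarrow> c\<^sub>0 \<longrightarrow> P \<longlonglongrightarrow> exp (- exp (- c\<^sub>0))) \<and>
         (filterlim c at_top sequentially \<longrightarrow> P \<longlonglongrightarrow> 1)"
proof -
  define few where "few n \<longleftrightarrow> real (m n) < (1 - \<epsilon>) * feature_threshold n" for n
  define a where "a n = degree_correction \<epsilon> n (m n) (p n)" for n
  \<comment> \<open>If a range is met only finitely often, its filter is \<open>bot\<close> and all
    limits along it hold trivially, so no case distinction arises.\<close>
  define F1 where "F1 = inf sequentially (principal {n. few n})"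
  define F2 where "F2 = inf sequentially (principal {n. \<not> few n})"
  have F1: "F1 \<le> sequentially" and F2: "F2 \<le> sequentially" by (auto simp: F1_def F2_def)
  have p': "0 < p n" "p n < 1" for n using p by auto
  have c_lim: "(\<lambda>n. c n / ln (real n)) \<longlonglongrightarrow> 0" using c by (rule smalloD_tendsto)
  \<comment> \<open>Clearing the denominator requires m > 0, which follows from ln^2 n <= m for
    large n.\<close>
  have eq': "\<forall>\<^sub>F n in sequentially. real (m n) * useful_prob n (p n) = ln (real n) + ln (a n) + c n"
  proof -
    have "\<forall>\<^sub>F n in sequentially. ln (real n) > 0" by real_asymp
    with eq landau_o.smallD[OF m, of 1, simplified] show ?thesis
    proof eventually_elim
      case (elim n)
      then have "(ln (real n))\<^sup>2 > 0" by simp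
      with elim have "real (m n) > 0" by linarith
      with elim(1) show ?case by (simp add: useful_prob_def a_def)
    qed
  qed
  have few1: "\<forall>\<^sub>F n in F1. real (m n) < (1 - \<epsilon>) * feature_threshold n"
    unfolding F1_def eventually_inf_principal by (simp add: few_def)
  \<comment> \<open>The complement of \<open>few\<close> selects the second branch of
    \<open>degree_correction\<close>; the dichotomy upgrades it to the lower bound on m.\<close>
  have many2: "\<forall>\<^sub>F n in F2. (1 + \<epsilon>) * feature_threshold n < real (m n)"
    unfolding F2_def eventually_inf_principal using dichotomy
    by eventually_elim (auto simp: few_def)
  have a1: "\<forall>\<^sub>F n in F1. a n = 1"
    unfolding F1_def eventually_inf_principal by (simp add: few_def a_def degree_correction_def)
  have a2: "\<forall>\<^sub>F n in F2. a n = real n * p n * ln (real n) / (exp (real n * p n) - 1)"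
    unfolding F2_def eventually_inf_principal by (simp add: few_def a_def degree_correction_def)
  have m': "(\<lambda>n. (ln (real n))\<^sup>2) \<in> o[F](\<lambda>n. real (m n))" if "F \<le> sequentially" for F
    using that m by (rule landau_o.small.filter_mono)
  interpret R1: regime F1 m p a c
  proof
    show "((\<lambda>n. ln (a n) / ln (real n)) \<longlongrightarrow> 0) F1"
    proof (rule Lim_transform_eventually[OF tendsto_const])
      show "\<forall>\<^sub>F n in F1. 0 = ln (a n) / ln (real n)" using a1 by eventually_elim simp
    qed
    show "\<forall>\<^sub>F n in F1. a n > 0" using a1 by eventually_elim simp
  qed (use F1 p' m'[OF F1] filter_leD[OF F1 eq'] tendsto_mono[OF F1 c_lim] in auto)
  interpret R2: regime F2 m p a c
  proof
    show "((\<lambda>n. ln (a n) / ln (real n)) \<longlongrightarrow> 0) F2"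
      by (rule ln_correction_tendsto[OF F2 eps p' many2 a2 filter_leD[OF F2 eq'] tendsto_mono[OF F2 c_lim]])
    show "\<forall>\<^sub>F n in F2. a n > 0"
      using a2 filter_leD[OF F2 eventually_ge_at_top[of 2]]
    proof eventually_elim
      case (elim n)
      then have "0 < real n * p n" using p'(1)[of n] by simp
      then show ?case unfolding elim(1) using elim(2) p'(1)[of n] by (intro divide_pos_pos mult_pos_pos) auto
    qed
  qed (use F2 p' m'[OF F2] filter_leD[OF F2 eq'] tendsto_mono[OF F2 c_lim] in auto)
  note lim1 = R1.isolated_limits[OF a1 R1.few_features_pairs_tendsto[OF eps few1], folded P_def]
  note lim2 = R2.pendant_limits[OF R2.many_features_limits[OF eps many2 a2], folded P_def]
  have split: "(P \<longlongrightarrow> l) sequentially" if "(P \<longlongrightarrow> l) F1" "(P \<longlongrightarrow> l) F2" for l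
    using that unfolding F1_def F2_def by (rule tendsto_split_principal)
  show ?thesis
  proof (intro conjI impI allI)
    assume "filterlim c at_bot sequentially"
    then have "filterlim c at_bot F1" "filterlim c at_bot F2"
      using F1 F2 by (auto intro: filterlim_mono)
    then show "P \<longlonglongrightarrow> 0" by (intro split lim1(1) lim2(1))
  next
    fix c\<^sub>0 assume "c \<longlonglongrightarrow> c\<^sub>0"
    then have "(c \<longlongrightarrow> c\<^sub>0) F1" "(c \<longlongrightarrow> c\<^sub>0) F2"
      using F1 F2 by (auto intro: tendsto_mono)
    then show "P \<longlonglongrightarrow> exp (- exp (- c\<^sub>0))" by (intro split lim1(2) lim2(2))
  next
    assume "filterlim c at_top sequentially"
    then have "filterlim c at_top F1" "filterlim c at_top F2"
      using F1 F2 by (auto intro: filterlim_mono)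
    then show "P \<longlonglongrightarrow> 1" by (intro split lim1(3) lim2(3))
  qed
qed

end
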